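(* Let $q=2^f>8$. There is no nontrivial $2$-$(v,k,2)$ design $\mathcal{D}$ with $(v,b,r,k)=\left(\frac{q(q-1)}{2},\,2(q^2-1),\,2(q+1),\,\frac{q}{2}\right)$ admitting a flag-transitive automorphism group $G$ with $\mathrm{Soc}(G)=T\cong PSL(2,q)$ such that $T_x\cong D_{2(q+1)}$ for a point $x$ and $T_B\cong Z_2^{f-1}$ or $T_B\cong Z_2^{f}$ for a block $B$.
   Context: A $2$-$(v,k,2)$ design: $v$ points, blocks of size $k$, every two distinct points in exactly $2$ blocks; $b$ is the number of blocks and $r$ the number of blocks through a point; nontrivial means $2<k<v-1$. Flag-transitive means transitive on incident point-block pairs. $D_n$ is the dihedral group of order $n$; $T_x,T_B$ are stabilizers in $T$. *)

theory Defs
  imports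
    "HOL-Analysis.Determinants"
    "HOL-Algebra.Group_Action"
    "HOL-Algebra.Elementary_Groups"
    "HOL-Algebra.Product_Groups"
begin

subsection \<open>Designs and their automorphisms\<close>

text \<open>
  Blocks are subsets of the point set, so designs are simple. This is essential:
  duplicating every block of the Witt--Bose--Shrikhande linear space on \<open>q (q - 1) / 2\<close>
  points gives a flag-transitive \<open>\<lambda> = 2\<close> incidence structure with repeated blocks and
  group \<open>PSL(2,q)\<close>, \<open>q = 2 ^ f\<close>.
\<close>

definition two_design :: "'a set \<Rightarrow> 'a set set \<Rightarrow> nat \<Rightarrow> nat \<Rightarrow> nat \<Rightarrow> bool" where
  "two_design P Bs v k l \<longleftrightarrow>
     finite P \<and> card P = v \<and>
     (\<forall>B\<in>Bs. B \<subseteq> P \<and> card B = k) \<and>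
     (\<forall>x\<in>P. \<forall>y\<in>P. x \<noteq> y \<longrightarrow> card {B \<in> Bs. x \<in> B \<and> y \<in> B} = l)"

definition nontrivial_two_design :: "'a set \<Rightarrow> 'a set set \<Rightarrow> nat \<Rightarrow> nat \<Rightarrow> nat \<Rightarrow> bool" where
  "nontrivial_two_design P Bs v k l \<longleftrightarrow> two_design P Bs v k l \<and> 2 < k \<and> k < v - 1"

definition design_aut_group :: "'a set \<Rightarrow> 'a set set \<Rightarrow> ('a \<Rightarrow> 'a) monoid" where
  "design_aut_group P Bs = (BijGroup P)\<lparr>carrier := {g \<in> Bij P. (\<lambda>B. g ` B) ` Bs = Bs}\<rparr>"

definition flag_transitive :: "'a set \<Rightarrow> 'a set set \<Rightarrow> ('a \<Rightarrow> 'a) set \<Rightarrow> bool" where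
  "flag_transitive P Bs G \<longleftrightarrow>
     (\<forall>x\<in>P. \<forall>B\<in>Bs. \<forall>y\<in>P. \<forall>C\<in>Bs. x \<in> B \<longrightarrow> y \<in> C \<longrightarrow> (\<exists>g\<in>G. g x = y \<and> g ` B = C))"


subsection \<open>The socle\<close>

definition minimal_normal :: "'a set \<Rightarrow> ('a, 'b) monoid_scheme \<Rightarrow> bool" where
  "minimal_normal N G \<longleftrightarrow>
     N \<lhd> G \<and> N \<noteq> {\<one>\<^bsub>G\<^esub>} \<and> (\<forall>M. M \<lhd> G \<longrightarrow> M \<subseteq> N \<longrightarrow> M = {\<one>\<^bsub>G\<^esub>} \<or> M = N)"

definition socle :: "('a, 'b) monoid_scheme \<Rightarrow> 'a set" where
  "socle G = generate G (\<Union>{N. minimal_normal N G})"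


subsection \<open>The groups occurring in the statement\<close>

definition SL :: "('a::field^'n^'n) monoid" where
  "SL = \<lparr>carrier = {A. det A = 1}, monoid.mult = (**), one = mat 1\<rparr>"

text \<open>The scalar matrices of determinant one form the centre of \<open>SL\<close>.\<close>

definition PSL :: "('a::field^'n^'n) set monoid" where
  "PSL = SL Mod {A \<in> carrier SL. \<exists>c. A = mat c}"

text \<open>
  The index is the order of the (even order) group. The pair \<open>(i, s)\<close> stands for
  \<open>\<rho> ^ i \<sigma> ^ s\<close> with a rotation \<open>\<rho>\<close> of order \<open>n / 2\<close> and a reflection \<open>\<sigma>\<close>, where
  \<open>\<sigma> \<rho> \<sigma> = \<rho> ^ (-1)\<close>.
\<close>

definition dihedral_group :: "nat \<Rightarrow> (int \<times> bool) monoid" where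
  "dihedral_group n =
     (let R = integer_mod_group (n div 2) in
      \<lparr>carrier = carrier R \<times> UNIV,
       monoid.mult = (\<lambda>(i, s) (j, t). (i \<otimes>\<^bsub>R\<^esub> (if s then inv\<^bsub>R\<^esub> j else j), s \<noteq> t)),
       one = (\<one>\<^bsub>R\<^esub>, False)\<rparr>)"

definition elem_abelian_2_group :: "nat \<Rightarrow> (nat \<Rightarrow> int) monoid" where
  "elem_abelian_2_group n = product_group {..<n} (\<lambda>_. integer_mod_group 2)"

end

theory Submission
  imports Defs
begin

text \<open>
  In \<open>T = PSL(2,q)\<close>, \<open>q\<close> even, there are \<open>q\<^sup>2 - 1\<close> involutions, all conjugate, and the
  centralizer \<open>C(t)\<close> of an involution \<open>t\<close> is elementary abelian of order \<open>q\<close>. Counting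
  with \<open>T\<^sub>x\<close> dihedral of order \<open>2 (q + 1)\<close> shows that \<open>Fix t\<close> has \<open>q / 2\<close> points, is an
  orbit of \<open>C(t)\<close>, and that the sets \<open>Fix s\<close> with \<open>s \<in> C(t) - {1}\<close> partition the points.

  If \<open>|T\<^sub>B| = q\<close>, then \<open>T\<^sub>B\<close> is such a centralizer, so \<open>B\<close>, and with it every block, is
  of the form \<open>Fix s\<close>; but there are more blocks than involutions.

  If \<open>|T\<^sub>B| = q / 2\<close>, then \<open>T\<close> is transitive on blocks, no block is of the form \<open>Fix s\<close>, and
  for every flag \<open>(x, C)\<close> the group \<open>T\<^sub>x \<inter> T\<^sub>C\<close> contains exactly one involution. Hence for
  \<open>x \<in> Fix t\<close> exactly two blocks \<open>C\<close>, \<open>C'\<close> through \<open>x\<close> are fixed by \<open>t\<close>. As \<open>t\<close> permutes the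
  two blocks through \<open>x\<close> and another point of \<open>Fix t\<close>, we get \<open>C \<inter> Fix t = C' \<inter> Fix t\<close>.
  This set is invariant under \<open>T\<^sub>C\<close> and under an element of \<open>C(t) - T\<^sub>C\<close>: one of \<open>T\<^sub>C\<^sub>'\<close> if
  \<open>T\<^sub>C \<noteq> T\<^sub>C\<^sub>'\<close>, and otherwise one taking \<open>C\<close> to \<open>C'\<close>, which normalizes \<open>T\<^sub>C\<close> and so lies in
  \<open>C(t)\<close>. Therefore it is invariant under \<open>C(t)\<close>, which forces \<open>C = Fix t\<close>.
\<close>

subsection \<open>Involutions and their centralizers\<close>

definition involutions :: "('a, 'b) monoid_scheme \<Rightarrow> 'a set" where
  "involutions G = {t \<in> carrier G. t \<noteq> \<one>\<^bsub>G\<^esub> \<and> t \<otimes>\<^bsub>G\<^esub> t = \<one>\<^bsub>G\<^esub>}"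

definition centralizer :: "('a, 'b) monoid_scheme \<Rightarrow> 'a \<Rightarrow> 'a set" where
  "centralizer G t = {g \<in> carrier G. g \<otimes>\<^bsub>G\<^esub> t = t \<otimes>\<^bsub>G\<^esub> g}"

lemma (in group) subgroup_centralizer:
  assumes "t \<in> carrier G"
  shows "subgroup (centralizer G t) G"
proof (rule subgroupI)
  fix a b assume a: "a \<in> centralizer G t" and b: "b \<in> centralizer G t"
  show "a \<otimes> b \<in> centralizer G t"
    using a b assms unfolding centralizer_def by (auto simp: m_assoc) (simp flip: m_assoc)
  show "inv a \<in> centralizer G t"
    using a assms unfolding centralizer_def
    by simp (metis inv_solve_left inv_solve_right m_assoc inv_closed m_closed)
qed (use assms in \<open>auto simp: centralizer_def\<close>)

text \<open>The usual argument that exponent two forces commutativity, kept to one pair: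
  \<open>a \<otimes> b\<close> is its own inverse, and that inverse is
  \<open>b \<otimes> a\<close>.\<close>

lemma (in group) square_one_imp_commute:
  assumes c: "a \<in> carrier G" "b \<in> carrier G"
    and "a \<otimes> a = \<one>" "b \<otimes> b = \<one>" "a \<otimes> b \<otimes> (a \<otimes> b) = \<one>"
  shows "a \<otimes> b = b \<otimes> a"
proof -
  have "a \<otimes> b = inv (a \<otimes> b)" using assms inv_equality[of "a \<otimes> b" "a \<otimes> b"] by simp
  also have "\<dots> = inv b \<otimes> inv a" using c by (simp add: inv_mult_group)
  also have "\<dots> = b \<otimes> a" using assms inv_equality by simp
  finally show ?thesis .
qed

section \<open>Conjugation and orbit counting\<close>

lemma (in group) involutions_closed: "t \<in> involutions G \<Longrightarrow> t \<in> carrier G"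
  by (simp add: involutions_def)

lemma (in group) conj_eq_iff:
  assumes "g \<in> carrier G" "s \<in> carrier G" "t \<in> carrier G"
  shows "g \<otimes> t \<otimes> inv g = s \<longleftrightarrow> g \<otimes> t = s \<otimes> g"
  using inv_solve_right[of s "g \<otimes> t" g] assms by auto

lemma (in group) conj_neq_one:
  assumes "g \<in> carrier G" "h \<in> carrier G" "h \<noteq> \<one>"
  shows "g \<otimes> h \<otimes> inv g \<noteq> \<one>"
  using assms conj_eq_iff[OF assms(1) one_closed assms(2)] by simp

lemma (in group) conj_self_iff:
  assumes "g \<in> carrier G" "t \<in> carrier G"
  shows "g \<otimes> t \<otimes> inv g = t \<longleftrightarrow> g \<in> centralizer G t"
  using assms conj_eq_iff[OF assms(1,2,2)] by (simp add: centralizer_def)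

lemma (in group) involution_conj:
  assumes "g \<in> carrier G" "t \<in> involutions G"
  shows "g \<otimes> t \<otimes> inv g \<in> involutions G"
proof -
  have t: "t \<in> carrier G" "t \<noteq> \<one>" "t \<otimes> t = \<one>" using assms by (auto simp: involutions_def)
  have "g \<otimes> t \<otimes> inv g \<otimes> (g \<otimes> t \<otimes> inv g) = g \<otimes> t \<otimes> (inv g \<otimes> g) \<otimes> t \<otimes> inv g"
    using assms(1) t by (simp only: m_assoc inv_closed m_closed)
  also have "\<dots> = g \<otimes> (t \<otimes> t) \<otimes> inv g"
    using assms(1) t(1) by (simp only: l_inv r_one m_assoc inv_closed m_closed)
  also have "\<dots> = \<one>" using assms(1) t by simp
  finally have "g \<otimes> t \<otimes> inv g \<otimes> (g \<otimes> t \<otimes> inv g) = \<one>" .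
  moreover have "g \<otimes> t \<otimes> inv g \<noteq> \<one>"
    using conj_neq_one[OF assms(1) t(1,2)] .
  ultimately show ?thesis using assms(1) t by (simp add: involutions_def)
qed

text \<open>All orbits have the same length \<open>order G div m\<close>, so this length divides
  \<open>card E\<close>; multiplying by \<open>m\<close> gives the claim.\<close>

lemma (in group_action) card_dvd_of_card_stabilizer:
  assumes fin: "finite E" and stab: "\<And>x. x \<in> E \<Longrightarrow> card (stabilizer G \<phi> x) = m" and "m > 0"
  shows "order G dvd m * card E"
proof -
  have "order G div m dvd card (\<Union> (orbits G E \<phi>))"
  proof (rule dvd_partition)
    show "finite (\<Union> (orbits G E \<phi>))" using fin orbits_coverture by simp
    show "\<forall>c\<in>orbits G E \<phi>. order G div m dvd card c"
    proof
      fix c assume "c \<in> orbits G E \<phi>"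
      then obtain x where x: "x \<in> E" "c = orbit G \<phi> x" by (auto simp: orbits_def)
      have "order G = card c * m" using orbit_stabilizer_theorem[OF x(1)] stab[OF x(1)] x(2) by simp
      then show "order G div m dvd card c" using \<open>m > 0\<close> by simp
    qed
    show "\<forall>c1\<in>orbits G E \<phi>. \<forall>c2\<in>orbits G E \<phi>. c1 \<noteq> c2 \<longrightarrow> c1 \<inter> c2 = {}"
      using disjoint_union by blast
  qed
  then have d: "order G div m dvd card E" using orbits_coverture by simp
  \<comment> \<open>A point of \<open>E\<close> is needed to see that \<open>m\<close> divides
    \<open>order G\<close>; for empty \<open>E\<close> the claim is divisibility of 0.\<close>
  show ?thesis
  proof (cases "E = {}")
    case False
    then obtain x where "x \<in> E" by blast
    have "order G = card (orbit G \<phi> x) * m"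
      using orbit_stabilizer_theorem[OF \<open>x \<in> E\<close>] stab[OF \<open>x \<in> E\<close>] by simp
    then show ?thesis using mult_dvd_mono[OF dvd_refl[of m] d] \<open>m > 0\<close> by (simp add: mult.commute[of m])
  qed simp
qed

text \<open>\<open>S\<close> may be any set closed under conjugation, such as the involutions or a
  normal subgroup without its identity. The restricted lambda gives the extensional maps that
  \<open>Bij\<close> demands.\<close>

lemma (in group) conjugation_action:
  assumes inv: "\<And>g h. g \<in> carrier G \<Longrightarrow> h \<in> S \<Longrightarrow> g \<otimes> h \<otimes> inv g \<in> S" and S: "S \<subseteq> carrier G"
  shows "group_action G S (\<lambda>g. \<lambda>h\<in>S. g \<otimes> h \<otimes> inv g)"
proof -
  have bij: "(\<lambda>h\<in>S. g \<otimes> h \<otimes> inv g) \<in> Bij S" if g: "g \<in> carrier G" for g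
  proof -
    have "bij_betw (\<lambda>h\<in>S. g \<otimes> h \<otimes> inv g) S S"
    proof (rule bij_betw_byWitness[where f' = "\<lambda>h. inv g \<otimes> h \<otimes> g"])
      have 1: "inv g \<otimes> h \<otimes> g \<in> S" if "h \<in> S" for h
        using inv[of "inv g" h] g that by simp
      show "(\<lambda>h. inv g \<otimes> h \<otimes> g) ` S \<subseteq> S" using 1 by auto
      show "(\<lambda>h\<in>S. g \<otimes> h \<otimes> inv g) ` S \<subseteq> S" using inv g by auto
      show "\<forall>a\<in>S. inv g \<otimes> (\<lambda>h\<in>S. g \<otimes> h \<otimes> inv g) a \<otimes> g = a"
        using g S by (auto simp: m_assoc subset_iff) (simp flip: m_assoc)
      show "\<forall>a\<in>S. (\<lambda>h\<in>S. g \<otimes> h \<otimes> inv g) (inv g \<otimes> a \<otimes> g) = a"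
        using g S 1 by (auto simp: m_assoc subset_iff) (simp flip: m_assoc)
    qed
    then show ?thesis by (simp add: Bij_def)
  qed
  have "(\<lambda>g. \<lambda>h\<in>S. g \<otimes> h \<otimes> inv g) \<in> hom G (BijGroup S)"
  proof (rule homI)
    fix g k assume g: "g \<in> carrier G" and k: "k \<in> carrier G"
    show "(\<lambda>h\<in>S. g \<otimes> k \<otimes> h \<otimes> inv (g \<otimes> k)) =
      (\<lambda>h\<in>S. g \<otimes> h \<otimes> inv g) \<otimes>\<^bsub>BijGroup S\<^esub> (\<lambda>h\<in>S. k \<otimes> h \<otimes> inv k)"
      using g k S inv[OF k] bij[OF g] bij[OF k]
      by (auto simp: BijGroup_def compose_def fun_eq_iff restrict_def m_assoc inv_mult_group subset_iff)
  qed (use bij in \<open>auto simp: BijGroup_def\<close>)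
  then show ?thesis
    by (simp add: group_action_def group_hom_def group_hom_axioms_def group_BijGroup is_group)
qed

text \<open>The properties of PSL(2,q), q even, on which the counting rests. They are invariant
  under isomorphism, so they can be checked on matrices and then carried over to the socle.\<close>

locale even_PSL2 = group G for G (structure) +
  fixes q :: nat
  assumes q_even: "even q" and q_gt: "q > 2"
    and order_eq: "order G = q * (q\<^sup>2 - 1)"
    and card_involutions: "card (involutions G) = q\<^sup>2 - 1"
    and card_centralizer: "\<And>t. t \<in> involutions G \<Longrightarrow> card (centralizer G t) = q"
    and centralizer_square: "\<And>t s. t \<in> involutions G \<Longrightarrow> s \<in> centralizer G t \<Longrightarrow> s \<otimes> s = \<one>"
begin

text \<open>An infinite carrier would have \<open>order\<close> 0, so positivity of the order is
  what yields finiteness.\<close>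

lemma order_pos: "order G > 0"
proof -
  have "2 * 2 < q * q" using q_gt by (intro mult_strict_mono) auto
  then show ?thesis using order_eq q_gt by (simp add: power2_eq_square)
qed

lemma finite_carrier: "finite (carrier G)"
  using order_pos by (simp add: order_gt_0_iff_finite)

lemma centralizer_subset: "t \<in> involutions G \<Longrightarrow> centralizer G t \<subseteq> carrier G"
  by (auto simp: centralizer_def)

lemma centralizer_subgroup: "t \<in> involutions G \<Longrightarrow> subgroup (centralizer G t) G"
  by (simp add: subgroup_centralizer involutions_closed)

lemma self_in_centralizer: "t \<in> involutions G \<Longrightarrow> t \<in> centralizer G t"
  by (auto simp: centralizer_def involutions_def)

lemma centralizer_involution:
  assumes "t \<in> involutions G" "s \<in> centralizer G t" "s \<noteq> \<one>"
  shows "s \<in> involutions G"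
  using centralizer_square[OF assms(1,2)] assms(3) subsetD[OF centralizer_subset assms(2)] assms(1)
  unfolding involutions_def by blast

lemma centralizer_commute:
  assumes t: "t \<in> involutions G" and a: "a \<in> centralizer G t" and b: "b \<in> centralizer G t"
  shows "a \<otimes> b = b \<otimes> a"
proof -
  have c: "a \<in> carrier G" "b \<in> carrier G" using a b centralizer_subset[OF t] by auto
  have "a \<otimes> b \<in> centralizer G t"
    using subgroup.m_closed[OF centralizer_subgroup[OF t]] a b by simp
  then show ?thesis using c a b centralizer_square[OF t] by (intro square_one_imp_commute) auto
qed

text \<open>The centralizer of \<open>t\<close> is abelian, hence contained in that of
  \<open>s\<close>, and both have order \<open>q\<close>. So two distinct centralizers of
  involutions share only the identity.\<close>

lemma centralizer_eq:
  assumes t: "t \<in> involutions G" and s: "s \<in> centralizer G t" "s \<noteq> \<one>"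
  shows "centralizer G s = centralizer G t"
proof -
  have s': "s \<in> involutions G" using centralizer_involution[OF assms] .
  have "centralizer G t \<subseteq> centralizer G s"
    using centralizer_commute[OF t] s centralizer_subset[OF t] by (auto simp: centralizer_def)
  then show ?thesis
    using card_centralizer[OF t] card_centralizer[OF s'] finite_carrier centralizer_subset[OF s']
    by (metis card_subset_eq finite_subset)
qed

text \<open>By orbit-stabilizer a class of involutions has q (q^2 - 1) / q members, which is the
  number of all involutions.\<close>

lemma involutions_conjugate:
  assumes t: "t \<in> involutions G" and s: "s \<in> involutions G"
  obtains g where "g \<in> carrier G" "g \<otimes> t \<otimes> inv g = s"
proof -
  let ?I = "involutions G"
  let ?\<psi> = "\<lambda>g. \<lambda>h\<in>?I. g \<otimes> h \<otimes> inv g"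
  interpret conj: group_action G ?I ?\<psi>
    by (rule conjugation_action) (auto simp: involution_conj involutions_closed)
  have "stabilizer G ?\<psi> t = centralizer G t"
    using t involutions_closed[OF t] by (auto simp: stabilizer_def conj_self_iff centralizer_subset[THEN subsetD])
  then have "card (orbit G ?\<psi> t) * q = q * (q\<^sup>2 - 1)"
    using conj.orbit_stabilizer_theorem[OF t] card_centralizer[OF t] order_eq by simp
  then have "card (orbit G ?\<psi> t) = card ?I" using q_gt card_involutions by simp
  moreover have "orbit G ?\<psi> t \<subseteq> ?I" using t by (auto simp: orbit_def involution_conj)
  moreover have "finite ?I" using finite_carrier by (auto simp: involutions_def)
  ultimately have "s \<in> orbit G ?\<psi> t" using s card_subset_eq by metis
  then show thesis using that t by (auto simp: orbit_def)
qed

text \<open>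
  The normalizer of \<open>W\<close> acts by conjugation on \<open>W - {\<one>}\<close> and on \<open>C - {\<one>}\<close>, \<open>C\<close> the
  centralizer, always with stabilizers \<open>C\<close>; hence its order divides
  \<open>gcd (q (q / 2 - 1)) (q (q - 1)) = q\<close>.
\<close>

lemma normalizes_half_centralizer:
  assumes t: "t \<in> involutions G" and W: "W \<subseteq> centralizer G t" and card_W: "card W = q div 2"
    and one_W: "\<one> \<in> W"
    and g: "g \<in> carrier G" and gW: "(\<lambda>h. g \<otimes> h \<otimes> inv g) ` W = W"
  shows "g \<in> centralizer G t"
proof -
  let ?C = "centralizer G t"
  define N where "N = {g \<in> carrier G. (\<lambda>h. g \<otimes> h \<otimes> inv g) ` W = W}"
  have Wc: "W \<subseteq> carrier G" using W centralizer_subset[OF t] by blast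
  have NI: "a \<in> N" if "a \<in> carrier G" "(\<lambda>h. a \<otimes> h \<otimes> inv a) ` W = W" for a
    using that by (simp add: N_def)
  have NG: "a \<in> carrier G" and NW: "(\<lambda>h. a \<otimes> h \<otimes> inv a) ` W = W" if "a \<in> N" for a
    using that by (simp_all add: N_def)
  have subN: "subgroup N G"
  proof (rule subgroupI)
    show "N \<subseteq> carrier G" using NG by blast
    have "(\<lambda>h. \<one> \<otimes> h \<otimes> inv \<one>) ` W = W" using Wc by (force simp: image_iff subset_iff)
    then show "N \<noteq> {}" using NI by blast
  next
    fix a assume a: "a \<in> N"
    have "(\<lambda>h. inv a \<otimes> h \<otimes> inv (inv a)) ` (\<lambda>h. a \<otimes> h \<otimes> inv a) ` W = (\<lambda>h. h) ` W"
      unfolding image_image using NG[OF a] Wc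
      by (intro image_cong) (auto simp: m_assoc subset_iff, simp flip: m_assoc)
    then show "inv a \<in> N" using NG[OF a] by (intro NI) (auto simp: NW[OF a])
  next
    fix a b assume a: "a \<in> N" and b: "b \<in> N"
    have "(\<lambda>h. a \<otimes> b \<otimes> h \<otimes> inv (a \<otimes> b)) ` W = (\<lambda>h. a \<otimes> h \<otimes> inv a) ` (\<lambda>h. b \<otimes> h \<otimes> inv b) ` W"
      unfolding image_image using NG[OF a] NG[OF b] Wc
      by (intro image_cong) (auto simp: m_assoc subset_iff inv_mult_group)
    then show "a \<otimes> b \<in> N"
      using NG[OF a] NG[OF b] by (intro NI) (auto simp: NW[OF a] NW[OF b])
  qed
  let ?H = "G\<lparr>carrier := N\<rparr>"
  interpret H: group ?H using subgroup.subgroup_is_group[OF subN is_group] .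
  have invH: "inv\<^bsub>?H\<^esub> h = inv h" if "h \<in> N" for h
    using m_inv_consistent[OF subN that] .
  have CN: "?C \<subseteq> N"
  proof
    fix c assume c: "c \<in> ?C"
    have "c \<otimes> w \<otimes> inv c = w" if "w \<in> W" for w
      using centralizer_commute[OF t c] that W Wc c centralizer_subset[OF t] conj_eq_iff by blast
    then show "c \<in> N" using c centralizer_subset[OF t] by (intro NI) auto
  qed
  \<comment> \<open>The centralizer of each such \<open>s\<close> is \<open>?C\<close> again and
    lies in \<open>N\<close>, so intersecting it with \<open>N\<close> loses nothing.\<close>
  have fixC: "{g \<in> N. g \<otimes> s \<otimes> inv g = s} = ?C" if "s \<in> ?C" "s \<noteq> \<one>" for s
  proof -
    have "s \<in> carrier G" using that centralizer_subset[OF t] by blast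
    then have "{g \<in> N. g \<otimes> s \<otimes> inv g = s} = N \<inter> centralizer G s"
      using NG by (auto simp: conj_self_iff)
    also have "\<dots> = ?C" using CN centralizer_eq[OF t that] by blast
    finally show ?thesis .
  qed
  have dvd: "card N dvd q * card S"
    if SC: "S \<subseteq> ?C - {\<one>}" and S: "\<And>g h. g \<in> N \<Longrightarrow> h \<in> S \<Longrightarrow> g \<otimes> h \<otimes> inv g \<in> S" for S
  proof -
    let ?\<psi> = "\<lambda>g. \<lambda>h\<in>S. g \<otimes>\<^bsub>?H\<^esub> h \<otimes>\<^bsub>?H\<^esub> inv\<^bsub>?H\<^esub> g"
    interpret conj: group_action ?H S ?\<psi>
    proof (rule H.conjugation_action)
      show "g \<otimes>\<^bsub>?H\<^esub> h \<otimes>\<^bsub>?H\<^esub> inv\<^bsub>?H\<^esub> g \<in> S" if "g \<in> carrier ?H" "h \<in> S" for g h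
        using S[of g h] that invH[of g] by simp
      show "S \<subseteq> carrier ?H" using SC CN by auto
    qed
    have "order ?H dvd q * card S"
    proof (rule conj.card_dvd_of_card_stabilizer)
      show "finite S" using SC centralizer_subset[OF t] finite_carrier
        by (meson Diff_subset finite_subset subset_trans)
      fix s assume s: "s \<in> S"
      then have "stabilizer ?H ?\<psi> s = {g \<in> N. g \<otimes> s \<otimes> inv g = s}"
        by (auto simp: stabilizer_def invH)
      also have "\<dots> = ?C" using fixC[of s] s SC by blast
      finally show "card (stabilizer ?H ?\<psi> s) = q" using card_centralizer[OF t] by simp
    qed (use q_gt in simp)
    then show ?thesis by (simp add: order_def)
  qed
  have "card N dvd q * card (W - {\<one>})"
  proof (rule dvd)
    show "a \<otimes> h \<otimes> inv a \<in> W - {\<one>}" if "a \<in> N" "h \<in> W - {\<one>}" for a h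
      using NW[OF that(1)] conj_neq_one[OF NG[OF that(1)], of h] that(2) Wc by blast
  qed (use W in blast)
  then have d1: "card N dvd q * (q div 2 - 1)"
    using card_W one_W q_gt by (simp add: card_Diff_singleton)
  \<comment> \<open>As \<open>q\<close> is even and exceeds 2, \<open>q div 2\<close> is at least 2,
    so \<open>W\<close> is not trivial.\<close>
  obtain w where w: "w \<in> W" "w \<noteq> \<one>"
  proof -
    have "\<not> W \<subseteq> {\<one>}" if "q \<noteq> 2"
    proof
      assume "W \<subseteq> {\<one>}"
      then have "card W \<le> card {\<one>}" by (intro card_mono) auto
      with card_W q_gt q_even show False by (auto elim!: evenE)
    qed
    then show thesis using that q_gt by auto
  qed
  have wC: "w \<in> ?C" using w W by blast
  have wI: "w \<in> involutions G" using centralizer_involution[OF t wC w(2)] .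
  have "card N dvd q * card (?C - {\<one>})"
  proof (rule dvd)
    fix g h assume g: "g \<in> N" and h: "h \<in> ?C - {\<one>}"
    have gc: "g \<in> carrier G" and hc: "h \<in> carrier G" using NG[OF g] h centralizer_subset[OF t] by auto
    have gw: "g \<otimes> w \<otimes> inv g \<in> W" using NW[OF g] w by blast
    let ?w = "g \<otimes> w \<otimes> inv g" and ?h = "g \<otimes> h \<otimes> inv g"
    have w1: "?w \<noteq> \<one>" using conj_neq_one[OF gc _ w(2)] w Wc by blast
    have conj_mult: "(g \<otimes> x \<otimes> inv g) \<otimes> (g \<otimes> y \<otimes> inv g) = g \<otimes> (x \<otimes> y) \<otimes> inv g"
      if "x \<in> carrier G" "y \<in> carrier G" for x y
    proof -
      have "(g \<otimes> x \<otimes> inv g) \<otimes> (g \<otimes> y \<otimes> inv g) = g \<otimes> x \<otimes> (inv g \<otimes> g) \<otimes> y \<otimes> inv g"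
        using that gc by (simp only: m_assoc inv_closed m_closed)
      also have "\<dots> = g \<otimes> (x \<otimes> y) \<otimes> inv g"
        using that gc by (simp only: l_inv r_one m_assoc inv_closed m_closed)
      finally show ?thesis .
    qed
    \<comment> \<open>The commutation of \<open>h\<close> and \<open>w\<close> is conjugated by
      \<open>g\<close>. As \<open>?w\<close> lies in \<open>W\<close> and is not the identity, its
      centralizer is \<open>?C\<close>, which therefore contains \<open>?h\<close>.\<close>
    have "?h \<otimes> ?w = ?w \<otimes> ?h"
      using conj_mult centralizer_commute[OF t, of h w] h wC hc w Wc by auto
    then have "?h \<in> centralizer G ?w" using gc hc by (simp add: centralizer_def)
    also have "centralizer G ?w = ?C" using centralizer_eq[OF t _ w1] gw W by blast
    finally show "?h \<in> ?C - {\<one>}" using conj_neq_one[OF gc hc] h by blast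
  qed simp
  then have d2: "card N dvd q * (q - 1)"
    using card_centralizer[OF t] centralizer_subgroup[OF t] finite_carrier
    by (simp add: card_Diff_singleton subgroup.one_closed)
  \<comment> \<open>This combination of the two known multiples of \<open>card N\<close> isolates
    \<open>q\<close>; writing q = 2 (n + 1) keeps the truncated subtractions exact.\<close>
  have "q * (q - 1) - 2 * (q * (q div 2 - 1)) = q"
  proof -
    obtain m where m: "q = 2 * m" using q_even by blast
    with q_gt obtain n where "m = Suc n" by (cases m) auto
    then show ?thesis using m by (simp add: algebra_simps)
  qed
  then have "card N dvd q"
    using dvd_diff_nat[OF d2 dvd_mult[OF d1, of 2]] by simp
  then have "card N \<le> card ?C" using card_centralizer[OF t] q_gt by (simp add: dvd_imp_le)
  moreover have "finite N" using finite_subset[OF _ finite_carrier] NG by blast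
  ultimately have "?C = N" using CN card_seteq[of N ?C] by blast
  then show ?thesis using NI[OF g gW] by blast
qed

end

subsection \<open>Actions on points and on sets of points\<close>

context group_action
begin

text \<open>The plain image is the form in which the theorem states the block stabilizer. Its maps
  are not extensional, so orbit counting goes through a restricted action and
  \<open>set_stabilizer_eq\<close>.\<close>

abbreviation set_stabilizer :: "'c set \<Rightarrow> 'a set" where
  "set_stabilizer \<equiv> stabilizer G (\<lambda>g A. \<phi> g ` A)"

lemma act_one [simp]: "x \<in> E \<Longrightarrow> \<phi> \<one> x = x"
  using id_eq_one by (metis restrict_apply')

lemma act_closed: "g \<in> carrier G \<Longrightarrow> x \<in> E \<Longrightarrow> \<phi> g x \<in> E"
  using element_image by blast

lemma act_inv [simp]: "g \<in> carrier G \<Longrightarrow> x \<in> E \<Longrightarrow> \<phi> (inv g) (\<phi> g x) = x"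
  using orbit_sym_aux by blast

lemma act_inv' [simp]: "g \<in> carrier G \<Longrightarrow> x \<in> E \<Longrightarrow> \<phi> g (\<phi> (inv g) x) = x"
  using act_inv[of "inv g" x] group_hom
  by (simp add: group_hom_def group.inv_inv group.inv_closed del: act_inv)

lemma act_eq_iff: "g \<in> carrier G \<Longrightarrow> x \<in> E \<Longrightarrow> y \<in> E \<Longrightarrow> \<phi> g x = \<phi> g y \<longleftrightarrow> x = y"
  using inj_prop by (meson inj_on_eq_iff)

lemma image_act_mult:
  assumes "g \<in> carrier G" "h \<in> carrier G" "A \<subseteq> E"
  shows "\<phi> (g \<otimes> h) ` A = \<phi> g ` \<phi> h ` A"
  unfolding image_image using assms by (intro image_cong) (auto simp: composition_rule)

lemma image_act_one [simp]: "A \<subseteq> E \<Longrightarrow> \<phi> \<one> ` A = A"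
  by (force simp: image_iff subset_iff)

lemma image_act_inv [simp]: "g \<in> carrier G \<Longrightarrow> A \<subseteq> E \<Longrightarrow> \<phi> (inv g) ` \<phi> g ` A = A"
  by (force simp: image_iff subset_iff)

lemma image_act_eq_iff:
  "g \<in> carrier G \<Longrightarrow> A \<subseteq> E \<Longrightarrow> A' \<subseteq> E \<Longrightarrow> \<phi> g ` A = \<phi> g ` A' \<longleftrightarrow> A = A'"
  using inj_prop[of g] by (simp add: inj_on_image_eq_iff)

lemma card_image_act: "g \<in> carrier G \<Longrightarrow> A \<subseteq> E \<Longrightarrow> card (\<phi> g ` A) = card A"
  using inj_prop by (meson card_image inj_on_subset)

lemma stabilizer_iff: "g \<in> stabilizer G \<phi> x \<longleftrightarrow> g \<in> carrier G \<and> \<phi> g x = x"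
  by (simp add: stabilizer_def)

lemma set_stabilizer_iff: "g \<in> set_stabilizer A \<longleftrightarrow> g \<in> carrier G \<and> \<phi> g ` A = A"
  by (simp add: stabilizer_def)

lemma set_action:
  assumes "X \<subseteq> Pow E" and inv: "\<And>g A. g \<in> carrier G \<Longrightarrow> A \<in> X \<Longrightarrow> \<phi> g ` A \<in> X"
  shows "group_action G X (\<lambda>g. \<lambda>A\<in>X. \<phi> g ` A)"
proof -
  interpret group G using group_hom by (simp add: group_hom_def)
  have bij: "(\<lambda>A\<in>X. \<phi> g ` A) \<in> Bij X" if g: "g \<in> carrier G" for g
  proof -
    have "bij_betw (\<lambda>A\<in>X. \<phi> g ` A) X X"
    proof (rule bij_betw_byWitness[where f' = "\<lambda>A. \<phi> (inv g) ` A"])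
      show "\<forall>A\<in>X. \<phi> (inv g) ` (\<lambda>A\<in>X. \<phi> g ` A) A = A"
        using g assms(1) image_act_inv by (metis PowD restrict_apply' subset_eq)
      show "\<forall>A\<in>X. (\<lambda>A\<in>X. \<phi> g ` A) (\<phi> (inv g) ` A) = A"
      proof
        fix A assume A: "A \<in> X"
        then have "\<phi> g ` \<phi> (inv g) ` A = A" using image_act_inv[of "inv g" A] g assms(1) by auto
        then show "(\<lambda>A\<in>X. \<phi> g ` A) (\<phi> (inv g) ` A) = A" using inv[of "inv g"] g A by simp
      qed
    qed (use g inv in auto)
    then show ?thesis by (simp add: Bij_def)
  qed
  have "(\<lambda>g. \<lambda>A\<in>X. \<phi> g ` A) \<in> hom G (BijGroup X)"
  proof (rule homI)
    fix g h assume g: "g \<in> carrier G" and h: "h \<in> carrier G"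
    have "\<phi> (g \<otimes> h) ` A = \<phi> g ` \<phi> h ` A" if "A \<in> X" for A
      using that g h assms(1) by (intro image_act_mult) auto
    then show "(\<lambda>A\<in>X. \<phi> (g \<otimes> h) ` A) = (\<lambda>A\<in>X. \<phi> g ` A) \<otimes>\<^bsub>BijGroup X\<^esub> (\<lambda>A\<in>X. \<phi> h ` A)"
      using bij[OF g] bij[OF h] inv[OF h] by (auto simp: BijGroup_def compose_def fun_eq_iff restrict_def)
  qed (use bij in \<open>auto simp: BijGroup_def\<close>)
  then show ?thesis
    by (simp add: group_action_def group_hom_def group_hom_axioms_def group_BijGroup is_group)
qed

lemma power_set_action: "group_action G (Pow E) (\<lambda>g. \<lambda>A\<in>Pow E. \<phi> g ` A)"
  by (rule set_action) (use act_closed in auto)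

lemma set_stabilizer_eq: "A \<subseteq> E \<Longrightarrow> stabilizer G (\<lambda>g. \<lambda>A\<in>Pow E. \<phi> g ` A) A = set_stabilizer A"
  by (auto simp: stabilizer_def)

lemma set_stabilizer_subgroup: "A \<subseteq> E \<Longrightarrow> subgroup (set_stabilizer A) G"
  using group_action.stabilizer_subgroup[OF power_set_action, of A] by (simp add: set_stabilizer_eq)

lemma card_set_orbit: "A \<subseteq> E \<Longrightarrow> card {\<phi> g ` A | g. g \<in> carrier G} * card (set_stabilizer A) = order G"
  using group_action.orbit_stabilizer_theorem[OF power_set_action, of A]
  by (simp add: set_stabilizer_eq orbit_def)

text \<open>Orbit-stabilizer for the action restricted to \<open>H\<close>. It serves for
  centralizers acting on fixed points and for block stabilizers acting on their blocks.\<close>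

lemma card_subgroup_orbit:
  assumes "subgroup H G" "x \<in> E"
  shows "card ((\<lambda>h. \<phi> h x) ` H) * card (H \<inter> stabilizer G \<phi> x) = card H"
proof -
  have "(\<lambda>h. \<phi> h x) ` H = orbit (G\<lparr>carrier := H\<rparr>) \<phi> x" by (auto simp: orbit_def)
  moreover have "H \<inter> stabilizer G \<phi> x = stabilizer (G\<lparr>carrier := H\<rparr>) \<phi> x"
    using subgroup.subset[OF assms(1)] by (auto simp: stabilizer_def)
  ultimately show ?thesis
    using group_action.orbit_stabilizer_theorem[OF induced_action[OF assms(1)] assms(2)]
    by (simp add: order_def)
qed

lemma conj_mem_stabilizer_iff:
  assumes "g \<in> carrier G" "x \<in> E" "h \<in> carrier G"
  shows "g \<otimes> h \<otimes> inv g \<in> stabilizer G \<phi> (\<phi> g x) \<longleftrightarrow> h \<in> stabilizer G \<phi> x"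
proof -
  interpret group G using group_hom by (simp add: group_hom_def)
  have "\<phi> (g \<otimes> h \<otimes> inv g) (\<phi> g x) = \<phi> g (\<phi> h x)"
    using assms by (simp add: composition_rule act_closed)
  then show ?thesis using assms by (simp add: stabilizer_iff act_eq_iff act_closed)
qed

text \<open>This is why conjugate involutions fix equally many points, and why an image of a fixed
  point set under the group is again one.\<close>

lemma invariants_conj:
  assumes "g \<in> carrier G" "h \<in> carrier G"
  shows "invariants E \<phi> (g \<otimes> h \<otimes> inv g) = \<phi> g ` invariants E \<phi> h"
proof -
  interpret group G using group_hom by (simp add: group_hom_def)
  have conj: "\<phi> (g \<otimes> h \<otimes> inv g) y = \<phi> g (\<phi> h (\<phi> (inv g) y))" if "y \<in> E" for y
    using assms that act_closed by (simp add: composition_rule)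
  show ?thesis
  proof (intro equalityI subsetI)
    fix y assume y: "y \<in> invariants E \<phi> (g \<otimes> h \<otimes> inv g)"
    let ?z = "\<phi> (inv g) y"
    have yE: "y \<in> E" using y by (simp add: invariants_def)
    have z: "?z \<in> E" using yE assms act_closed by simp
    have "\<phi> g (\<phi> h ?z) = \<phi> g ?z" using y conj[OF yE] assms yE by (simp add: invariants_def)
    then have "\<phi> h ?z = ?z" using act_eq_iff[OF assms(1)] act_closed[OF assms(2) z] z by simp
    then have "?z \<in> invariants E \<phi> h" using z by (simp add: invariants_def)
    then show "y \<in> \<phi> g ` invariants E \<phi> h" using assms yE by (intro image_eqI[of _ _ ?z]) auto
  next
    fix y assume "y \<in> \<phi> g ` invariants E \<phi> h"
    then show "y \<in> invariants E \<phi> (g \<otimes> h \<otimes> inv g)"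
      using assms conj act_closed by (auto simp: invariants_def)
  qed
qed

lemma set_stabilizer_conj:
  assumes A: "A \<subseteq> E" and g: "g \<in> carrier G" and h: "h \<in> set_stabilizer A"
  shows "g \<otimes> h \<otimes> inv g \<in> set_stabilizer (\<phi> g ` A)"
proof -
  interpret group G using group_hom by (simp add: group_hom_def)
  have hc: "h \<in> carrier G" "\<phi> h ` A = A" using h by (auto simp: set_stabilizer_iff)
  have "\<phi> (g \<otimes> h \<otimes> inv g) ` \<phi> g ` A = \<phi> (g \<otimes> h \<otimes> inv g \<otimes> g) ` A"
    using image_act_mult[of "g \<otimes> h \<otimes> inv g" g A] g hc A by simp
  also have "g \<otimes> h \<otimes> inv g \<otimes> g = g \<otimes> h" using g hc by (simp add: m_assoc)
  also have "\<phi> (g \<otimes> h) ` A = \<phi> g ` A" using image_act_mult[OF g hc(1) A] hc by simp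
  finally show ?thesis using g hc by (simp add: set_stabilizer_iff)
qed

end

subsection \<open>The action with dihedral point stabilizers\<close>

text \<open>Stabilizer data are given at the single point \<open>x\<^sub>0\<close> and spread by
  transitivity. The number q + 1 counts the reflections of a dihedral group of order 2 (q + 1), its
  only involutions because q + 1 is odd.\<close>

locale even_PSL2_action = even_PSL2 G q + group_action G P \<phi>
  for G (structure) and q and P :: "'p set" and \<phi> +
  fixes x\<^sub>0
  assumes finite_P: "finite P" and card_P: "card P = q * (q - 1) div 2"
    and base: "x\<^sub>0 \<in> P"
    and card_stab_base: "card (stabilizer G \<phi> x\<^sub>0) = 2 * (q + 1)"
    and card_inv_stab_base: "card (involutions G \<inter> stabilizer G \<phi> x\<^sub>0) = q + 1"
begin

abbreviation Fix where "Fix \<equiv> invariants P \<phi>"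
abbreviation Stab where "Stab \<equiv> stabilizer G \<phi>"

lemma card_P_mult: "card P * (2 * (q + 1)) = q * (q\<^sup>2 - 1)"
proof -
  obtain m where m: "q = 2 * m" using q_even by blast
  then have "q * (q - 1) div 2 * 2 = q * (q - 1)" by simp
  then have "card P * (2 * (q + 1)) = q * (q - 1) * (q + 1)"
    using card_P by (metis mult.assoc)
  also have "\<dots> = q * (q\<^sup>2 - 1)" by (simp add: power2_eq_square algebra_simps)
  finally show ?thesis .
qed

text \<open>The orbit of \<open>x\<^sub>0\<close> has q (q^2 - 1) / (2 (q + 1)) points, as many as
  \<open>P\<close>, so the action is transitive.\<close>

lemma orbit_eq: "y \<in> P \<Longrightarrow> orbit G \<phi> y = P"
proof -
  have sub: "orbit G \<phi> y \<subseteq> P" if "y \<in> P" for y using that act_closed by (auto simp: orbit_def)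
  have "card (orbit G \<phi> x\<^sub>0) * (2 * (q + 1)) = card P * (2 * (q + 1))"
    using orbit_stabilizer_theorem[OF base] card_stab_base order_eq card_P_mult by simp
  then have "card (orbit G \<phi> x\<^sub>0) = card P" by (metis mult_cancel2 add_is_0 one_neq_zero mult_eq_0_iff zero_neq_numeral)
  then have o: "orbit G \<phi> x\<^sub>0 = P" using sub[OF base] finite_P by (simp add: card_subset_eq)
  assume y: "y \<in> P"
  then have "x\<^sub>0 \<in> orbit G \<phi> y" using orbit_sym base o by blast
  then have "P \<subseteq> orbit G \<phi> y" using orbit_trans[OF y base] o by blast
  then show ?thesis using sub[OF y] by blast
qed

lemma transitive:
  assumes "x \<in> P" "y \<in> P"
  obtains g where "g \<in> carrier G" "\<phi> g x = y"
  using orbit_eq[OF assms(1)] assms(2) that by (auto simp: orbit_def)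

lemma card_Stab: "y \<in> P \<Longrightarrow> card (Stab y) = 2 * (q + 1)"
proof -
  assume y: "y \<in> P"
  have "card P * card (Stab y) = card P * (2 * (q + 1))"
    using orbit_stabilizer_theorem[OF y] orbit_eq[OF y] order_eq card_P_mult by simp
  moreover have "card P > 0" using base finite_P by (auto simp: card_gt_0_iff)
  ultimately show ?thesis by (metis mult_left_cancel less_numeral_extra(3))
qed

lemma finite_involutions: "finite (involutions G)"
  using finite_carrier by (auto simp: involutions_def)

lemma finite_Fix: "finite (Fix t)"
  using finite_P by (simp add: invariants_def)

lemma card_involutions_Stab:
  assumes "y \<in> P"
  shows "card (involutions G \<inter> Stab y) = q + 1"
proof -
  obtain g where g: "g \<in> carrier G" "\<phi> g x\<^sub>0 = y" using transitive[OF base assms] .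
  let ?c = "\<lambda>h. g \<otimes> h \<otimes> inv g"
  have "bij_betw ?c (involutions G \<inter> Stab x\<^sub>0) (involutions G \<inter> Stab y)"
  proof (rule bij_betw_byWitness[where f' = "\<lambda>h. inv g \<otimes> h \<otimes> g"])
    show "\<forall>a\<in>involutions G \<inter> Stab x\<^sub>0. inv g \<otimes> ?c a \<otimes> g = a"
      using g(1) by (auto simp: involutions_def m_assoc) (simp flip: m_assoc)
    show "\<forall>a\<in>involutions G \<inter> Stab y. ?c (inv g \<otimes> a \<otimes> g) = a"
      using g(1) by (auto simp: involutions_def m_assoc) (simp flip: m_assoc)
    show "?c ` (involutions G \<inter> Stab x\<^sub>0) \<subseteq> involutions G \<inter> Stab y"
      using conj_mem_stabilizer_iff[OF g(1) base] involution_conj[OF g(1)] involutions_closed g(2) by auto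
    show "(\<lambda>h. inv g \<otimes> h \<otimes> g) ` (involutions G \<inter> Stab y) \<subseteq> involutions G \<inter> Stab x\<^sub>0"
    proof
      fix h' assume "h' \<in> (\<lambda>h. inv g \<otimes> h \<otimes> g) ` (involutions G \<inter> Stab y)"
      then obtain h where h: "h \<in> involutions G" "h \<in> Stab y" "h' = inv g \<otimes> h \<otimes> g" by blast
      have "\<phi> (inv g) y = x\<^sub>0" using g base by auto
      then show "h' \<in> involutions G \<inter> Stab x\<^sub>0"
        using conj_mem_stabilizer_iff[of "inv g" y h] involution_conj[of "inv g" h] involutions_closed g(1) assms h
        by auto
    qed
  qed
  then show ?thesis using bij_betw_same_card card_inv_stab_base by fastforce
qed

text \<open>Double counting of the pairs (s, y) of an involution and a point fixed by it:
  involutions are conjugate and fix equally many points, and each point is fixed by q + 1 of them,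
  so (q^2 - 1) |Fix t| = |P| (q + 1).\<close>

lemma card_Fix:
  assumes t: "t \<in> involutions G"
  shows "card (Fix t) = q div 2"
proof -
  have eq: "card (Fix s) = card (Fix t)" if s: "s \<in> involutions G" for s
  proof -
    obtain g where g: "g \<in> carrier G" "g \<otimes> t \<otimes> inv g = s" using involutions_conjugate[OF t s] .
    then have "Fix s = \<phi> g ` Fix t" using invariants_conj[OF g(1) involutions_closed[OF t]] by simp
    moreover have "card (\<phi> g ` Fix t) = card (Fix t)"
      by (rule card_image_act[OF g(1)]) (auto simp: invariants_def)
    ultimately show ?thesis by simp
  qed
  have "(\<Sum>s\<in>involutions G. card (Fix s)) = (\<Sum>s\<in>involutions G. \<Sum>y\<in>P. if \<phi> s y = y then 1 else 0)"
    unfolding invariants_def using finite_P by (intro sum.cong refl) (simp add: sum.If_cases Int_def)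
  also have "\<dots> = (\<Sum>y\<in>P. \<Sum>s\<in>involutions G. if \<phi> s y = y then 1 else 0)" by (rule sum.swap)
  also have "\<dots> = (\<Sum>y\<in>P. card (involutions G \<inter> Stab y))"
  proof (intro sum.cong refl)
    fix y
    have "involutions G \<inter> Stab y = involutions G \<inter> {s. \<phi> s y = y}"
      using involutions_closed by (auto simp: stabilizer_iff)
    then show "(\<Sum>s\<in>involutions G. if \<phi> s y = y then 1 else 0) = card (involutions G \<inter> Stab y)"
      using finite_involutions by (simp add: sum.If_cases)
  qed
  also have "\<dots> = card P * (q + 1)" using card_involutions_Stab by simp
  finally have sum: "(\<Sum>s\<in>involutions G. card (Fix s)) = card P * (q + 1)" .
  have "(\<Sum>s\<in>involutions G. card (Fix s)) = (\<Sum>s\<in>involutions G. card (Fix t))"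
    by (intro sum.cong refl eq)
  then have "(q\<^sup>2 - 1) * card (Fix t) = card P * (q + 1)"
    using sum card_involutions by simp
  then have "(q\<^sup>2 - 1) * (2 * card (Fix t)) = (q\<^sup>2 - 1) * q" using card_P_mult by (simp add: algebra_simps)
  moreover have "q\<^sup>2 - 1 > 0" using order_pos order_eq by simp
  ultimately have "2 * card (Fix t) = q" by simp
  then show ?thesis by simp
qed

text \<open>The intersection of the centralizer with a point stabilizer has order dividing both q
  and 2 (q + 1), hence at most 2. So distinct nonidentity elements of one centralizer have disjoint
  fixed point sets.\<close>

lemma stab_centralizer_unique:
  assumes t: "t \<in> involutions G" and y: "y \<in> P"
    and s: "s \<in> centralizer G t" "\<phi> s y = y" "s \<noteq> \<one>"
    and u: "u \<in> centralizer G t" "\<phi> u y = y" "u \<noteq> \<one>"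
  shows "s = u"
proof (rule ccontr)
  assume ne: "s \<noteq> u"
  let ?D = "centralizer G t \<inter> Stab y"
  have D: "subgroup ?D G"
    using centralizer_subgroup[OF t] stabilizer_subgroup[OF y] by (rule subgroups_Inter_pair)
  have "subgroup ?D (G\<lparr>carrier := centralizer G t\<rparr>)"
    using D centralizer_subgroup[OF t] by (intro subgroup_incl) auto
  then have "card ?D dvd order (G\<lparr>carrier := centralizer G t\<rparr>)"
    using group.lagrange[OF subgroup.subgroup_is_group[OF centralizer_subgroup[OF t] is_group]]
    by (metis dvd_triv_right)
  then have 1: "card ?D dvd q" using card_centralizer[OF t] by (simp add: order_def)
  have "subgroup ?D (G\<lparr>carrier := Stab y\<rparr>)"
    using D stabilizer_subgroup[OF y] by (intro subgroup_incl) auto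
  then have "card ?D dvd order (G\<lparr>carrier := Stab y\<rparr>)"
    using group.lagrange[OF subgroup.subgroup_is_group[OF stabilizer_subgroup[OF y] is_group]]
    by (metis dvd_triv_right)
  then have 2: "card ?D dvd 2 * (q + 1)" using card_Stab[OF y] by (simp add: order_def)
  have "card ?D dvd 2 * (q + 1) - 2 * q" using 1 2 by (intro dvd_diff_nat) auto
  then have "card ?D \<le> 2" by (auto dest: dvd_imp_le)
  moreover have "{\<one>, s, u} \<subseteq> ?D"
    using s u subgroup.one_closed[OF D] centralizer_subset[OF t] by (auto simp: stabilizer_iff)
  then have "card {\<one>, s, u} \<le> card ?D"
    using finite_subset[OF subgroup.subset[OF D] finite_carrier] by (rule card_mono[rotated])
  moreover have "card {\<one>, s, u} = 3" using s u ne by auto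
  ultimately show False by simp
qed

text \<open>The q - 1 nonidentity elements of the centralizer have disjoint fixed point sets of size
  q / 2, which together exhaust the q (q - 1) / 2 points.\<close>

lemma ex_centralizer_fixing:
  assumes t: "t \<in> involutions G" and y: "y \<in> P"
  obtains s where "s \<in> centralizer G t" "s \<in> involutions G" "y \<in> Fix s"
proof -
  let ?C = "centralizer G t - {\<one>}"
  have fin: "finite ?C" using finite_subset[OF centralizer_subset[OF t] finite_carrier] by simp
  have "card (\<Union>s\<in>?C. Fix s) = (\<Sum>s\<in>?C. card (Fix s))"
  proof (rule card_UN_disjoint)
    show "\<forall>i\<in>?C. \<forall>j\<in>?C. i \<noteq> j \<longrightarrow> Fix i \<inter> Fix j = {}"
      using stab_centralizer_unique[OF t] by (auto simp: invariants_def)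
  qed (use fin finite_Fix in auto)
  also have "\<dots> = (\<Sum>s\<in>?C. q div 2)"
    using card_Fix centralizer_involution[OF t] by (intro sum.cong) auto
  also have "\<dots> = (q - 1) * (q div 2)"
    using card_centralizer[OF t] subgroup.one_closed[OF centralizer_subgroup[OF t]]
    by (simp add: card_Diff_singleton)
  also have "\<dots> = card P" using q_even card_P by (auto elim!: evenE)
  finally have "(\<Union>s\<in>?C. Fix s) = P"
    using finite_P by (intro card_subset_eq) (auto simp: invariants_def)
  then obtain s where "s \<in> ?C" "y \<in> Fix s" using y by blast
  then show thesis using that centralizer_involution[OF t] by blast
qed

text \<open>A permutation commuting with \<open>t\<close> preserves the property of being fixed by
  \<open>t\<close>. The set \<open>A\<close> will be a single point, all of \<open>P\<close>, or a
  block.\<close>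

lemma centralizer_act_Fix:
  assumes t: "t \<in> involutions G" and u: "u \<in> centralizer G t" and A: "A \<subseteq> P"
  shows "\<phi> u ` (A \<inter> Fix t) = \<phi> u ` A \<inter> Fix t"
proof -
  have c: "u \<in> carrier G" "t \<in> carrier G" "u \<otimes> t = t \<otimes> u"
    using u involutions_closed[OF t] by (auto simp: centralizer_def)
  have "\<phi> t (\<phi> u y) = \<phi> u y \<longleftrightarrow> \<phi> t y = y" if "y \<in> P" for y
  proof -
    have "\<phi> t (\<phi> u y) = \<phi> u (\<phi> t y)" using composition_rule[OF that] c by metis
    then show ?thesis using that c act_eq_iff act_closed by metis
  qed
  then show ?thesis using A c act_closed by (auto simp: invariants_def subset_iff)
qed

text \<open>The stabilizer of \<open>x\<close> in the centralizer is {1, t}, so the orbit has q / 2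
  points; it lies in \<open>Fix t\<close>, which is no larger.\<close>

lemma Fix_transitive:
  assumes t: "t \<in> involutions G" and x: "x \<in> Fix t"
  shows "(\<lambda>u. \<phi> u x) ` centralizer G t = Fix t"
proof -
  have xP: "x \<in> P" "\<phi> t x = x" using x by (auto simp: invariants_def)
  have "centralizer G t \<inter> Stab x = {\<one>, t}"
    using stab_centralizer_unique[OF t xP(1) _ _ _ self_in_centralizer[OF t] xP(2)]
      subgroup.one_closed[OF centralizer_subgroup[OF t]] self_in_centralizer[OF t] t xP
      involutions_closed[OF t]
    by (auto simp: stabilizer_iff involutions_def)
  moreover have "card {\<one>, t} = 2" using t by (auto simp: involutions_def)
  ultimately have "card ((\<lambda>u. \<phi> u x) ` centralizer G t) * 2 = q"
    using card_subgroup_orbit[OF centralizer_subgroup[OF t] xP(1)] card_centralizer[OF t] by simp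
  moreover have "(\<lambda>u. \<phi> u x) ` centralizer G t \<subseteq> Fix t"
  proof
    fix z assume "z \<in> (\<lambda>u. \<phi> u x) ` centralizer G t"
    then obtain u where u: "u \<in> centralizer G t" "z = \<phi> u x" by blast
    have "\<phi> u ` ({x} \<inter> Fix t) = \<phi> u ` {x} \<inter> Fix t"
      using centralizer_act_Fix[OF t u(1)] xP(1) by blast
    then show "z \<in> Fix t" using x u(2) by auto
  qed
  ultimately show ?thesis using card_Fix[OF t] finite_Fix by (intro card_subset_eq) auto
qed

lemma centralizer_image_Fix:
  assumes t: "t \<in> involutions G" and u: "u \<in> centralizer G t"
  shows "\<phi> u ` Fix t = Fix t"
proof -
  have c: "u \<in> carrier G" using u by (simp add: centralizer_def)
  have "\<phi> u ` (P \<inter> Fix t) = \<phi> u ` P \<inter> Fix t" by (rule centralizer_act_Fix[OF t u]) simp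
  moreover have "P \<inter> Fix t = Fix t" by (auto simp: invariants_def)
  ultimately show ?thesis using surj_prop[OF c] by simp
qed

text \<open>Some involution \<open>s\<close> of the centralizer fixes a chosen point of
  \<open>C\<close>. The orbit of that point is \<open>Fix s\<close>, lies in \<open>C\<close>, and
  has the size of \<open>C\<close>. Here \<open>s\<close> may differ from \<open>t\<close>.\<close>

lemma centralizer_invariant_eq_Fix:
  assumes t: "t \<in> involutions G" and inv: "\<And>u. u \<in> centralizer G t \<Longrightarrow> \<phi> u ` C = C"
    and C: "C \<subseteq> P" "card C = q div 2"
  obtains s where "s \<in> involutions G" "C = Fix s"
proof -
  have "C \<noteq> {}" using C(2) q_gt by auto
  then obtain x where x: "x \<in> C" by blast
  then obtain s where s: "s \<in> centralizer G t" "s \<in> involutions G" "x \<in> Fix s"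
    using ex_centralizer_fixing[OF t] C(1) by blast
  have "centralizer G s = centralizer G t"
    using centralizer_eq[OF t s(1)] s(2) by (simp add: involutions_def)
  then have "Fix s \<subseteq> C" using Fix_transitive[OF s(2,3)] inv x by blast
  then have "Fix s = C"
    using C finite_P card_Fix[OF s(2)] by (intro card_subset_eq) (auto intro: finite_subset)
  then show thesis using that s(2) by blast
qed

end

subsection \<open>Block stabilizers of order q / 2\<close>

text \<open>The order and exponent of the stabilizer are given for the block \<open>B\<close> only;
  block transitivity, obtained by counting, extends them to every block.\<close>

locale biplane_action = even_PSL2_action +
  fixes Bs :: "'c set set" and B
  assumes q_ge: "q > 4"
    and block: "C \<in> Bs \<Longrightarrow> C \<subseteq> P" and card_block: "C \<in> Bs \<Longrightarrow> card C = q div 2"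
    and block_act: "g \<in> carrier G \<Longrightarrow> C \<in> Bs \<Longrightarrow> \<phi> g ` C \<in> Bs"
    and pairs: "x \<in> P \<Longrightarrow> y \<in> P \<Longrightarrow> x \<noteq> y \<Longrightarrow> card {C \<in> Bs. x \<in> C \<and> y \<in> C} = 2"
    and replication: "y \<in> P \<Longrightarrow> card {C \<in> Bs. y \<in> C} = 2 * (q + 1)"
    and card_Bs: "card Bs = 2 * (q\<^sup>2 - 1)"
    and base_block: "B \<in> Bs" and card_base_stab: "card (set_stabilizer B) = q div 2"
    and base_stab_square: "h \<in> set_stabilizer B \<Longrightarrow> h \<otimes> h = \<one>"
begin

lemma finite_Bs: "finite Bs"
  using block finite_P by (intro finite_subset[of Bs "Pow P"]) auto

lemma set_stabilizer_closed: "h \<in> set_stabilizer C \<Longrightarrow> h \<in> carrier G"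
  by (simp add: set_stabilizer_iff)

lemma finite_set_stabilizer: "finite (set_stabilizer C)"
  by (rule finite_subset[OF _ finite_carrier]) (auto simp: set_stabilizer_iff)

text \<open>The index of the stabilizer of \<open>B\<close> is q (q^2 - 1) / (q / 2) = 2 (q^2 - 1),
  the number of blocks.\<close>

lemma base_block_orbit: "{\<phi> g ` B | g. g \<in> carrier G} = Bs"
proof -
  have "card {\<phi> g ` B | g. g \<in> carrier G} * (q div 2) = q * (q\<^sup>2 - 1)"
    using card_set_orbit[OF block[OF base_block]] card_base_stab order_eq by simp
  also have "\<dots> = 2 * (q div 2) * (q\<^sup>2 - 1)" using q_even by simp
  also have "\<dots> = card Bs * (q div 2)" by (simp add: card_Bs)
  finally have "card {\<phi> g ` B | g. g \<in> carrier G} = card Bs" using q_gt by auto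
  then show ?thesis using block_act[OF _ base_block] finite_Bs by (intro card_subset_eq) auto
qed

lemma block_transitive:
  assumes C: "C \<in> Bs" and C': "C' \<in> Bs"
  obtains g where "g \<in> carrier G" "\<phi> g ` C = C'"
proof -
  obtain g where g: "g \<in> carrier G" "C = \<phi> g ` B" using C base_block_orbit by blast
  obtain h where h: "h \<in> carrier G" "C' = \<phi> h ` B" using C' base_block_orbit by blast
  have BP: "B \<subseteq> P" using block[OF base_block] .
  have "\<phi> (h \<otimes> inv g) ` C = \<phi> h ` \<phi> (inv g) ` \<phi> g ` B"
    using g h block[OF C] image_act_mult[of h "inv g" C] by simp
  also have "\<dots> = C'" using image_act_inv[OF g(1) BP] h(2) by simp
  finally show thesis using that[of "h \<otimes> inv g"] g h by simp
qed

lemma card_block_stab: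
  assumes C: "C \<in> Bs"
  shows "card (set_stabilizer C) = q div 2"
proof -
  have "{\<phi> g ` C | g. g \<in> carrier G} = Bs" using block_act[OF _ C] block_transitive[OF C] by blast
  then have "card Bs * card (set_stabilizer C) = card Bs * (q div 2)"
    using card_set_orbit[OF block[OF C]] card_set_orbit[OF block[OF base_block]]
      base_block_orbit card_base_stab by simp
  moreover have "card Bs > 0" using base_block finite_Bs by (auto simp: card_gt_0_iff)
  ultimately show ?thesis by (metis mult_left_cancel less_numeral_extra(3))
qed

text \<open>Conjugation moves \<open>h\<close> into the stabilizer of \<open>B\<close> and back; the
  identity is set apart so that lemmas on involutions apply.\<close>

lemma block_stab_square:
  assumes C: "C \<in> Bs" and h: "h \<in> set_stabilizer C"
  shows "h \<otimes> h = \<one>"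
proof (cases "h = \<one>")
  case False
  obtain g where g: "g \<in> carrier G" "\<phi> g ` C = B" using block_transitive[OF C base_block] .
  have hc: "h \<in> carrier G" "\<phi> h ` C = C" using h by (auto simp: set_stabilizer_iff)
  let ?h = "g \<otimes> h \<otimes> inv g"
  have "?h \<in> set_stabilizer B" using set_stabilizer_conj[OF block[OF C] g(1) h] g(2) by simp
  then have "?h \<otimes> ?h = \<one>" by (rule base_stab_square)
  then have "?h \<in> involutions G"
    using conj_neq_one[OF g(1) hc(1) False] g hc by (simp add: involutions_def)
  then have "inv g \<otimes> ?h \<otimes> inv (inv g) \<in> involutions G"
    using involution_conj[of "inv g" ?h] g by blast
  moreover have "inv g \<otimes> ?h \<otimes> inv (inv g) = h"
    using g hc by (simp add: m_assoc) (simp flip: m_assoc)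
  ultimately show ?thesis by (simp add: involutions_def)
qed simp

lemma block_stab_involution:
  "C \<in> Bs \<Longrightarrow> h \<in> set_stabilizer C \<Longrightarrow> h \<noteq> \<one> \<Longrightarrow> h \<in> involutions G"
  using block_stab_square set_stabilizer_closed unfolding involutions_def by blast

lemma block_stab_subset_centralizer:
  assumes C: "C \<in> Bs" and w: "w \<in> set_stabilizer C"
  shows "set_stabilizer C \<subseteq> centralizer G w"
proof
  fix h assume h: "h \<in> set_stabilizer C"
  have c: "h \<in> carrier G" "w \<in> carrier G" using h w set_stabilizer_closed by auto
  have "h \<otimes> w \<in> set_stabilizer C"
    using subgroup.m_closed[OF set_stabilizer_subgroup[OF block[OF C]]] h w by blast
  then have "h \<otimes> w = w \<otimes> h"
    using c h w block_stab_square[OF C] by (intro square_one_imp_commute) auto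
  then show "h \<in> centralizer G w" using c by (simp add: centralizer_def)
qed

text \<open>\<open>Fix t\<close> is stabilized by the whole centralizer of \<open>t\<close>, of
  order q, whereas a block stabilizer has order q / 2.\<close>

lemma block_neq_Fix:
  assumes C: "C \<in> Bs" and t: "t \<in> involutions G"
  shows "C \<noteq> Fix t"
proof
  assume eq: "C = Fix t"
  have "centralizer G t \<subseteq> set_stabilizer C"
    using centralizer_image_Fix[OF t] centralizer_subset[OF t] eq by (auto simp: set_stabilizer_iff)
  then have "q \<le> q div 2"
    using card_mono[OF finite_set_stabilizer] card_centralizer[OF t] card_block_stab[OF C] by metis
  then show False using q_gt by simp
qed

text \<open>
  Otherwise \<open>T\<^sub>C\<close> would be semiregular on the orbit of \<open>x\<close>, which would then be all of \<open>C\<close>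
  and equal to the fixed point set of an involution.
\<close>

lemma flag_involution:
  assumes C: "C \<in> Bs" and x: "x \<in> C"
  obtains s where "s \<in> set_stabilizer C" "s \<in> involutions G" "x \<in> Fix s"
proof -
  have xP: "x \<in> P" using block[OF C] x by blast
  let ?W = "set_stabilizer C"
  have one: "\<one> \<in> ?W" using subgroup.one_closed[OF set_stabilizer_subgroup[OF block[OF C]]] .
  obtain w where w: "w \<in> ?W" "w \<noteq> \<one>"
  proof -
    have "\<not> ?W \<subseteq> {\<one>}"
    proof
      assume "?W \<subseteq> {\<one>}"
      then have "card ?W \<le> card {\<one>}" by (intro card_mono) auto
      with card_block_stab[OF C] q_ge show False by simp
    qed
    then show thesis using that by blast
  qed
  have wI: "w \<in> involutions G" using block_stab_involution[OF C w] .
  have WC: "?W \<subseteq> centralizer G w" using block_stab_subset_centralizer[OF C w(1)] .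
  obtain s where s: "s \<in> centralizer G w" "s \<in> involutions G" "x \<in> Fix s"
    using ex_centralizer_fixing[OF wI xP] .
  have "s \<in> ?W"
  proof (rule ccontr)
    assume sW: "s \<notin> ?W"
    have s1: "\<phi> s x = x" "s \<noteq> \<one>" using s by (auto simp: invariants_def involutions_def)
    \<comment> \<open>A nonidentity \<open>h\<close> fixing \<open>x\<close> would equal
      \<open>s\<close>, since both lie in the centralizer of \<open>w\<close>; but \<open>s\<close>
      is outside \<open>?W\<close>.\<close>
    have "h = \<one>" if "h \<in> ?W" "\<phi> h x = x" for h
      using stab_centralizer_unique[OF wI xP, of s h] s(1) s1 that WC sW by blast
    then have "?W \<inter> Stab x \<subseteq> {\<one>}" unfolding stabilizer_def by blast
    then have "?W \<inter> Stab x = {\<one>}"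
      using one subgroup.one_closed[OF stabilizer_subgroup[OF xP]] by blast
    then have "card ((\<lambda>h. \<phi> h x) ` ?W) = card C"
      using card_subgroup_orbit[OF set_stabilizer_subgroup[OF block[OF C]] xP]
        card_block_stab[OF C] card_block[OF C] by simp
    moreover have "(\<lambda>h. \<phi> h x) ` ?W \<subseteq> C"
      using x by (metis image_eqI image_subsetI set_stabilizer_iff)
    ultimately have orb: "(\<lambda>h. \<phi> h x) ` ?W = C"
      using block[OF C] finite_P by (intro card_subset_eq) (auto intro: finite_subset)
    \<comment> \<open>Thus \<open>?W\<close> centralizes \<open>s\<close>, and the orbit of
      \<open>x\<close>, now known to be \<open>C\<close>, stays inside \<open>Fix s\<close>.\<close>
    have "centralizer G s = centralizer G w" using centralizer_eq[OF wI s(1) s1(2)] .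
    then have "C \<subseteq> Fix s" using Fix_transitive[OF s(2,3)] WC orb by blast
    then have "C = Fix s"
      using card_block[OF C] card_Fix[OF s(2)] finite_Fix by (intro card_subset_eq) auto
    then show False using block_neq_Fix[OF C s(2)] by blast
  qed
  then show thesis using that s by blast
qed

text \<open>Existence is \<open>flag_involution\<close>. For uniqueness, the block stabilizer lies
  in the centralizer of \<open>s\<close>, where only one nonidentity element fixes
  \<open>x\<close>.\<close>

lemma card_flag_involutions:
  assumes C: "C \<in> Bs" and x: "x \<in> C"
  shows "card {t \<in> involutions G \<inter> Stab x. t \<in> set_stabilizer C} = 1"
proof -
  have xP: "x \<in> P" using block[OF C] x by blast
  obtain s where s: "s \<in> set_stabilizer C" "s \<in> involutions G" "x \<in> Fix s"
    using flag_involution[OF assms] .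
  have "t = s" if "t \<in> involutions G" "\<phi> t x = x" "t \<in> set_stabilizer C" for t
    using stab_centralizer_unique[OF s(2) xP, of t s] that s self_in_centralizer[OF s(2)]
      block_stab_subset_centralizer[OF C s(1)] by (auto simp: invariants_def involutions_def)
  then have "{t \<in> involutions G \<inter> Stab x. t \<in> set_stabilizer C} \<subseteq> {s}"
    unfolding stabilizer_def by blast
  moreover have "s \<in> Stab x" using s involutions_closed by (simp add: stabilizer_iff invariants_def)
  ultimately have "{t \<in> involutions G \<inter> Stab x. t \<in> set_stabilizer C} = {s}" using s by blast
  then show ?thesis by simp
qed

section \<open>Blocks through a point that are fixed by an involution\<close>

definition fixed_blocks :: "'c \<Rightarrow> 'a \<Rightarrow> 'c set set" where
  "fixed_blocks x t = {C \<in> Bs. x \<in> C \<and> t \<in> set_stabilizer C}"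

text \<open>An element of the stabilizer of \<open>x\<close> conjugating \<open>t\<close> to
  \<open>s\<close> maps the blocks fixed by \<open>t\<close> injectively to blocks fixed by
  \<open>s\<close>. Exchanging \<open>t\<close> and \<open>s\<close> later gives equality.\<close>

lemma card_fixed_blocks_le:
  assumes x: "x \<in> P" and t: "t \<in> involutions G" "x \<in> Fix t" and s: "s \<in> involutions G" "x \<in> Fix s"
  shows "card (fixed_blocks x t) \<le> card (fixed_blocks x s)"
proof -
  obtain g where g: "g \<in> carrier G" "g \<otimes> t \<otimes> inv g = s" using involutions_conjugate[OF t(1) s(1)] .
  have tc: "t \<in> carrier G" and sc: "s \<in> carrier G" using t s involutions_closed by auto
  have gt: "s \<otimes> g = g \<otimes> t" using conj_eq_iff[OF g(1) sc tc] g by simp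
  have "\<phi> s (\<phi> g x) = \<phi> g x"
    using composition_rule[OF x sc g(1)] composition_rule[OF x g(1) tc] gt t(2)
    by (simp add: invariants_def)
  then have "\<phi> g x \<in> Fix s" using act_closed[OF g(1) x] by (simp add: invariants_def)
  \<comment> \<open>The conjugating element \<open>g\<close> need not fix \<open>x\<close>; it is
    corrected by an element of the centralizer of \<open>s\<close>, which is transitive on
    \<open>Fix s\<close>.\<close>
  then obtain u where u: "u \<in> centralizer G s" "\<phi> u (\<phi> g x) = x"
    using Fix_transitive[OF s(1)] s(2) by (metis (no_types, lifting) imageE)
  have uc: "u \<in> carrier G" "u \<otimes> s = s \<otimes> u" using u by (auto simp: centralizer_def)
  define h where "h = u \<otimes> g"
  have h: "h \<in> carrier G" "\<phi> h x = x"
    using uc g u x by (simp_all add: h_def composition_rule)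
  have "s \<otimes> h = h \<otimes> t"
    using uc g sc tc gt by (metis h_def m_assoc)
  have "(\<lambda>C. \<phi> h ` C) ` fixed_blocks x t \<subseteq> fixed_blocks x s"
  proof
    fix D assume "D \<in> (\<lambda>C. \<phi> h ` C) ` fixed_blocks x t"
    then obtain C where C: "C \<in> Bs" "x \<in> C" "\<phi> t ` C = C" "D = \<phi> h ` C"
      by (auto simp: fixed_blocks_def set_stabilizer_iff)
    have "\<phi> s ` \<phi> h ` C = \<phi> h ` \<phi> t ` C"
      using image_act_mult[OF sc h(1) block[OF C(1)]] image_act_mult[OF h(1) tc block[OF C(1)]]
        \<open>s \<otimes> h = h \<otimes> t\<close> by simp
    then have "s \<in> set_stabilizer D" using C sc by (simp add: set_stabilizer_iff)
    moreover have "x \<in> D" using C(2,4) h(2) by (metis imageI)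
    moreover have "D \<in> Bs" using C block_act[OF h(1)] by simp
    ultimately show "D \<in> fixed_blocks x s" by (simp add: fixed_blocks_def)
  qed
  moreover have "inj_on (\<lambda>C. \<phi> h ` C) (fixed_blocks x t)"
    using image_act_eq_iff[OF h(1)] block by (auto simp: inj_on_def fixed_blocks_def)
  moreover have "finite (fixed_blocks x s)" using finite_Bs by (simp add: fixed_blocks_def)
  ultimately show ?thesis by (metis card_image card_mono)
qed

text \<open>Double counting of involutions \<open>s\<close> fixing \<open>x\<close> against blocks
  through \<open>x\<close> fixed by \<open>s\<close>: each of the 2 (q + 1) blocks occurs once, and
  the q + 1 involutions share them equally.\<close>

lemma card_fixed_blocks:
  assumes x: "x \<in> P" and t: "t \<in> involutions G" "x \<in> Fix t"
  shows "card (fixed_blocks x t) = 2"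
proof -
  let ?I = "involutions G \<inter> Stab x" and ?B = "{C \<in> Bs. x \<in> C}"
  have finI: "finite ?I" using finite_involutions by simp
  have finB: "finite ?B" using finite_Bs by simp
  have "(\<Sum>s\<in>?I. card (fixed_blocks x s)) = (\<Sum>s\<in>?I. card {C \<in> ?B. s \<in> set_stabilizer C})"
    by (intro sum.cong refl arg_cong[where f = card]) (auto simp: fixed_blocks_def)
  also have "\<dots> = (\<Sum>s\<in>?I. \<Sum>C\<in>?B. if s \<in> set_stabilizer C then 1 else 0)"
    by (intro sum.cong refl card_as_sums finB)
  also have "\<dots> = (\<Sum>C\<in>?B. \<Sum>s\<in>?I. if s \<in> set_stabilizer C then 1 else 0)" by (rule sum.swap)
  also have "\<dots> = (\<Sum>C\<in>?B. card {s \<in> ?I. s \<in> set_stabilizer C})"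
    by (intro sum.cong[OF refl] card_as_sums[symmetric] refl finI)
  also have "\<dots> = (\<Sum>C\<in>?B. 1)" using card_flag_involutions by (intro sum.cong refl) auto
  also have "\<dots> = 2 * (q + 1)" using replication[OF x] by simp
  finally have sum: "(\<Sum>s\<in>?I. card (fixed_blocks x s)) = 2 * (q + 1)" .
  have "x \<in> Fix s" if "s \<in> ?I" for s
    using that x by (simp add: invariants_def stabilizer_iff)
  then have "(\<Sum>s\<in>?I. card (fixed_blocks x s)) = (\<Sum>s\<in>?I. card (fixed_blocks x t))"
    using card_fixed_blocks_le[OF x] t by (intro sum.cong refl antisym) auto
  then have "(q + 1) * card (fixed_blocks x t) = (q + 1) * 2"
    using sum card_involutions_Stab[OF x] by simp
  then show ?thesis by (simp only: mult_cancel1) simp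
qed

text \<open>For another point \<open>y\<close> of \<open>C\<close> fixed by \<open>t\<close>, the
  involution permutes the two blocks through \<open>x\<close> and \<open>y\<close>. It fixes
  \<open>C\<close>, hence also the other one, which must then be \<open>C'\<close>.\<close>

lemma second_fixed_block:
  assumes x: "x \<in> P" and t: "t \<in> involutions G" "x \<in> Fix t"
    and eq: "fixed_blocks x t = {C, C'}"
  shows "C \<inter> Fix t \<subseteq> C'"
proof
  fix y assume y: "y \<in> C \<inter> Fix t"
  have C: "C \<in> Bs" "x \<in> C" "\<phi> t ` C = C" and C': "C' \<in> Bs" "x \<in> C'"
    using eq[THEN equalityD2] by (auto simp: fixed_blocks_def set_stabilizer_iff)
  have tc: "t \<in> carrier G" using involutions_closed[OF t(1)] .
  have fx: "\<phi> t x = x" "\<phi> t y = y" using y t by (auto simp: invariants_def)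
  show "y \<in> C'"
  proof (cases "y = x")
    case False
    have yP: "y \<in> P" using y by (simp add: invariants_def)
    let ?X = "{D \<in> Bs. x \<in> D \<and> y \<in> D}"
    have c: "card ?X = 2" "C \<in> ?X" using pairs[OF x yP] False C y by auto
    then obtain D D' where DD: "?X = {D, D'}" "D \<noteq> D'" unfolding card_2_iff by metis
    obtain D where D: "?X = {C, D}" "D \<noteq> C"
    proof (cases "C = D")
      case True
      then show thesis using that[of D'] DD by metis
    next
      case False
      then have "C = D'" using DD(1) c(2) by blast
      then show thesis using that[of D] DD by (metis insert_commute)
    qed
    have DB: "D \<in> Bs" "x \<in> D" "y \<in> D" using D(1) by blast+
    have "x \<in> \<phi> t ` D" "y \<in> \<phi> t ` D" using DB fx by (metis imageI)+
    then have "\<phi> t ` D \<in> ?X" using block_act[OF tc DB(1)] by simp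
    then have "\<phi> t ` D = C \<or> \<phi> t ` D = D" unfolding D(1) by simp
    \<comment> \<open>Otherwise \<open>t\<close> would send the distinct blocks \<open>C\<close> and
      \<open>D\<close> to the same block.\<close>
    moreover have "\<phi> t ` D \<noteq> C"
      using image_act_eq_iff[OF tc block[OF DB(1)] block[OF C(1)]] C(3) D(2) by simp
    ultimately have "\<phi> t ` D = D" by metis
    then have "D \<in> fixed_blocks x t" using DB tc by (simp add: fixed_blocks_def set_stabilizer_iff)
    then have "D = C'" using D(2) unfolding eq by simp
    then show ?thesis using DB(3) by simp
  qed (use C' in simp)
qed

lemma no_such_action: False
proof -
  let ?x = x\<^sub>0
  have "involutions G \<inter> Stab ?x \<noteq> {}" using card_involutions_Stab[OF base] by auto
  then obtain t where t: "t \<in> involutions G" "?x \<in> Fix t"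
    using base by (auto simp: stabilizer_iff invariants_def)
  have tc: "t \<in> carrier G" using involutions_closed[OF t(1)] .
  obtain C C' where eq: "fixed_blocks ?x t = {C, C'}" and ne: "C \<noteq> C'"
    using card_fixed_blocks[OF base t] by (auto simp: card_2_iff)
  have C: "C \<in> Bs" "?x \<in> C" "t \<in> set_stabilizer C" and C': "C' \<in> Bs" "?x \<in> C'" "t \<in> set_stabilizer C'"
    using eq[THEN equalityD2] by (auto simp: fixed_blocks_def)
  define K where "K = C \<inter> Fix t"
  have K': "K = C' \<inter> Fix t"
    using second_fixed_block[OF base t eq]
      second_fixed_block[OF base t eq[unfolded insert_commute[of C]]]
    unfolding K_def by blast
  let ?U = "centralizer G t"
  have sub: "set_stabilizer C \<subseteq> ?U" and sub': "set_stabilizer C' \<subseteq> ?U"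
    using block_stab_subset_centralizer C C' by auto
  have stabK: "\<phi> h ` K = K" if "h \<in> set_stabilizer C" for h
    using centralizer_act_Fix[OF t(1) subsetD[OF sub that] block[OF C(1)]] that
    by (simp add: K_def set_stabilizer_iff)
  \<comment> \<open>The stabilizer of \<open>C\<close> has index two in \<open>?U\<close>, so it and
    its coset by \<open>u\<close> make up \<open>?U\<close>. All of \<open>?U\<close> then keeps the
    orbit of \<open>?x\<close>, which is \<open>Fix t\<close>, inside \<open>K\<close>, and so
    \<open>C\<close> would be \<open>Fix t\<close>.\<close>
  have no: False if u: "u \<in> ?U" "u \<notin> set_stabilizer C" "\<phi> u ` K = K" for u
  proof -
    have uc: "u \<in> carrier G" using u(1) by (simp add: centralizer_def)
    let ?W = "set_stabilizer C"
    have W: "subgroup ?W G" using set_stabilizer_subgroup[OF block[OF C(1)]] .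
    have inj: "inj_on (\<lambda>w. u \<otimes> w) ?W"
      using uc by (auto simp: inj_on_def set_stabilizer_iff)
    have disj: "?W \<inter> (\<lambda>w. u \<otimes> w) ` ?W = {}"
    proof -
      have False if "w \<in> ?W" "u \<otimes> w \<in> ?W" for w
      proof -
        have "u \<otimes> w \<otimes> inv w \<in> ?W"
          using that subgroup.m_closed[OF W] subgroup.m_inv_closed[OF W] by blast
        then show False using u(2) uc set_stabilizer_closed[OF that(1)] by (simp add: m_assoc)
      qed
      then show ?thesis by auto
    qed
    have "card (?W \<union> (\<lambda>w. u \<otimes> w) ` ?W) = q div 2 + q div 2"
      using disj card_image[OF inj] card_block_stab[OF C(1)] finite_set_stabilizer
      by (simp add: card_Un_disjoint)
    also have "\<dots> = card ?U" using card_centralizer[OF t(1)] q_even by auto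
    finally have "?W \<union> (\<lambda>w. u \<otimes> w) ` ?W = ?U"
      using sub u(1) subgroup.m_closed[OF centralizer_subgroup[OF t(1)]]
        finite_subset[OF centralizer_subset[OF t(1)] finite_carrier]
      by (intro card_subset_eq) auto
    moreover have "?x \<in> K" using C t by (simp add: K_def)
    moreover have "\<phi> (u \<otimes> w) ?x \<in> K" if "w \<in> ?W" for w
    proof -
      have "\<phi> w ?x \<in> K" using stabK[OF that] \<open>?x \<in> K\<close> by blast
      then show ?thesis using composition_rule[OF base uc set_stabilizer_closed[OF that]] u(3) by auto
    qed
    moreover have "\<phi> w ?x \<in> K" if "w \<in> ?W" for w using stabK[OF that] \<open>?x \<in> K\<close> by blast
    ultimately have "(\<lambda>u. \<phi> u ?x) ` ?U \<subseteq> K" by (metis (no_types, lifting) Un_iff image_iff image_subsetI)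
    then have "Fix t \<subseteq> C" using Fix_transitive[OF t] by (simp add: K_def)
    then have "Fix t = C"
      using card_block[OF C(1)] card_Fix[OF t(1)] finite_subset[OF block[OF C(1)] finite_P]
      by (intro card_subset_eq) auto
    then show False using block_neq_Fix[OF C(1) t(1)] by simp
  qed
  show False
  proof (cases "set_stabilizer C = set_stabilizer C'")
    case False
    have "\<not> set_stabilizer C' \<subseteq> set_stabilizer C"
      using False card_block_stab C(1) C'(1) finite_set_stabilizer card_subset_eq by metis
    then obtain u where u: "u \<in> set_stabilizer C'" "u \<notin> set_stabilizer C" by blast
    have "\<phi> u ` K = K"
      using centralizer_act_Fix[OF t(1) subsetD[OF sub' u(1)] block[OF C'(1)]] u(1)
      by (simp add: K' set_stabilizer_iff)
    then show False using no u sub' by blast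
  next
    case True
    obtain g where g: "g \<in> carrier G" "\<phi> g ` C = C'" using block_transitive[OF C(1) C'(1)] .
    have "g \<notin> set_stabilizer C" using g ne by (simp add: set_stabilizer_iff)
    moreover have gU: "g \<in> ?U"
    \<comment> \<open>Conjugation by \<open>g\<close> takes the stabilizer of \<open>C\<close> to
      that of \<open>C'\<close>, which is the same group of order q / 2, so \<open>g\<close>
      normalizes it.\<close>
    proof (rule normalizes_half_centralizer[OF t(1) sub card_block_stab[OF C(1)] _ g(1)])
      show "\<one> \<in> set_stabilizer C"
        using subgroup.one_closed[OF set_stabilizer_subgroup[OF block[OF C(1)]]] .
      have "g \<otimes> h \<otimes> inv g \<in> set_stabilizer C" if h: "h \<in> set_stabilizer C" for h
        using set_stabilizer_conj[OF block[OF C(1)] g(1) h] g(2) True by simp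
      then show "(\<lambda>h. g \<otimes> h \<otimes> inv g) ` set_stabilizer C = set_stabilizer C"
        using finite_set_stabilizer conjugation_is_inj[OF g(1)] set_stabilizer_closed[of _ C]
        by (intro endo_inj_surj inj_onI) blast+
    qed
    moreover have "\<phi> g ` K = K"
      using centralizer_act_Fix[OF t(1) gU block[OF C(1)]] g(2) K' by (simp add: K_def)
    ultimately show False using no by blast
  qed
qed

end

subsection \<open>Isomorphisms\<close>

lemma involutions_carrier_update:
  "S \<subseteq> carrier G \<Longrightarrow> involutions (G\<lparr>carrier := S\<rparr>) = involutions G \<inter> S"
  by (auto simp: involutions_def)

text \<open>Here \<open>H\<close> is any record with a product, so that
  \<open>dihedral_group\<close> can be treated without its group axioms. Idempotence of the image of
  the unit, with uniqueness of idempotents in \<open>H\<close>, stands in for preservation of the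
  unit.\<close>

lemma (in group) iso_one_idempotent:
  assumes "h \<in> iso G H"
  shows "h \<one> \<otimes>\<^bsub>H\<^esub> h \<one> = h \<one>"
proof -
  have "h (\<one> \<otimes> \<one>) = h \<one> \<otimes>\<^bsub>H\<^esub> h \<one>"
    using assms by (intro hom_mult[of h G H]) (auto simp: iso_def)
  then show ?thesis by simp
qed

lemma (in group) iso_image_involutions:
  assumes h: "h \<in> iso G H"
    and idem: "\<And>z. z \<in> carrier H \<Longrightarrow> z \<otimes>\<^bsub>H\<^esub> z = z \<Longrightarrow> z = \<one>\<^bsub>H\<^esub>"
  shows "h ` involutions G = involutions H"
proof -
  have hom: "h \<in> hom G H" and bij: "bij_betw h (carrier G) (carrier H)" using h by (auto simp: iso_def)
  have one: "h \<one> = \<one>\<^bsub>H\<^esub>"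
    using iso_one_idempotent[OF h] hom_in_carrier[OF hom one_closed] idem by blast
  have eq: "h x = h y \<longleftrightarrow> x = y" if "x \<in> carrier G" "y \<in> carrier G" for x y
    using bij that by (auto simp: bij_betw_def inj_on_eq_iff)
  have "h x \<in> involutions H \<longleftrightarrow> x \<in> involutions G" if x: "x \<in> carrier G" for x
    using eq[OF x one_closed] eq[of "x \<otimes> x" \<one>] hom_mult[OF hom x x] hom_in_carrier[OF hom x] one x
    by (simp add: involutions_def)
  moreover have "involutions H \<subseteq> h ` carrier G" using bij by (auto simp: bij_betw_def involutions_def)
  ultimately show ?thesis using involutions_closed by blast
qed

lemma (in group) iso_card_involutions:
  assumes h: "h \<in> iso G H"
    and idem: "\<And>z. z \<in> carrier H \<Longrightarrow> z \<otimes>\<^bsub>H\<^esub> z = z \<Longrightarrow> z = \<one>\<^bsub>H\<^esub>"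
  shows "card (involutions G) = card (involutions H)"
proof -
  have "inj_on h (involutions G)"
    using h by (auto simp: iso_def bij_betw_def intro: inj_on_subset dest: involutions_closed)
  then show ?thesis using iso_image_involutions[OF assms] by (metis card_image)
qed

lemma (in group) idempotent_eq_one: "z \<in> carrier G \<Longrightarrow> z \<otimes> z = z \<Longrightarrow> z = \<one>"
  using r_cancel_one'[of z z] by simp

lemma even_PSL2_iso:
  assumes G: "even_PSL2 G q" and H: "group H" and iso: "G \<cong> H"
  shows "even_PSL2 H q"
proof -
  interpret G: even_PSL2 G q by fact
  interpret H: group H by fact
  obtain h where h: "h \<in> iso G H" using iso by (auto simp: is_iso_def)
  have hom: "h \<in> hom G H" and bij: "bij_betw h (carrier G) (carrier H)" using h by (auto simp: iso_def)
  have inj: "inj_on h (carrier G)" using bij by (simp add: bij_betw_def)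
  have I: "h ` involutions G = involutions H"
    using G.iso_image_involutions[OF h] H.idempotent_eq_one by blast
  have C: "centralizer H (h t) = h ` centralizer G t" if t: "t \<in> carrier G" for t
  proof -
    have "h x \<in> centralizer H (h t) \<longleftrightarrow> x \<in> centralizer G t" if x: "x \<in> carrier G" for x
      using inj_on_eq_iff[OF inj, of "x \<otimes>\<^bsub>G\<^esub> t" "t \<otimes>\<^bsub>G\<^esub> x"] x t
        hom_mult[OF hom x t] hom_mult[OF hom t x] hom_in_carrier[OF hom x]
      by (simp add: centralizer_def)
    moreover have "centralizer H (h t) \<subseteq> h ` carrier G"
      using bij by (auto simp: bij_betw_def centralizer_def)
    moreover have "centralizer G t \<subseteq> carrier G" by (auto simp: centralizer_def)
    ultimately show ?thesis by blast
  qed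
  show ?thesis
  proof
    show "even q" "q > 2" using G.q_even G.q_gt by auto
    show "order H = q * (q\<^sup>2 - 1)" using iso_same_card[OF iso] G.order_eq by (simp add: order_def)
    show "card (involutions H) = q\<^sup>2 - 1"
      using G.iso_card_involutions[OF h] H.idempotent_eq_one G.card_involutions by metis
  next
    fix t' assume "t' \<in> involutions H"
    then obtain t where t: "t \<in> involutions G" "t' = h t" using I by blast
    have C': "centralizer H t' = h ` centralizer G t" using C t G.involutions_closed by blast
    have sub: "centralizer G t \<subseteq> carrier G" by (auto simp: centralizer_def)
    show "card (centralizer H t') = q"
      using C' card_image[OF inj_on_subset[OF inj sub]] G.card_centralizer[OF t(1)] by simp
    fix s' assume "s' \<in> centralizer H t'"
    then obtain s where s: "s \<in> centralizer G t" "s' = h s" using C' by blast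
    have sc: "s \<in> carrier G" using s sub by blast
    have "s' \<otimes>\<^bsub>H\<^esub> s' = h (s \<otimes>\<^bsub>G\<^esub> s)" using hom_mult[OF hom sc sc] s(2) by simp
    also have "\<dots> = h \<one>\<^bsub>G\<^esub>" using G.centralizer_square[OF t(1) s(1)] by simp
    also have "\<dots> = \<one>\<^bsub>H\<^esub>"
      using H.idempotent_eq_one[OF hom_in_carrier[OF hom G.one_closed] G.iso_one_idempotent[OF h]] .
    finally show "s' \<otimes>\<^bsub>H\<^esub> s' = \<one>\<^bsub>H\<^esub>" .
  qed
qed

section \<open>Dihedral groups\<close>

lemma carrier_dihedral_group: "n > 0 \<Longrightarrow> carrier (dihedral_group (2 * n)) = {0..<int n} \<times> UNIV"
  by (simp add: dihedral_group_def Let_def carrier_integer_mod_group)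

lemma dihedral_group_square:
  assumes "n > 0" "z \<in> carrier (dihedral_group (2 * n))"
  shows "z \<otimes>\<^bsub>dihedral_group (2 * n)\<^esub> z = (if snd z then (0, False) else (2 * fst z mod int n, False))"
  using assms
  by (cases z) (auto simp: dihedral_group_def Let_def carrier_integer_mod_group mod_simps)

text \<open>A reflection squares to a rotation, so it is not idempotent; for a rotation,
  \<open>2 * i\<close> congruent to \<open>i\<close> modulo \<open>n\<close> leaves only
  \<open>i = 0\<close>.\<close>

lemma dihedral_group_idempotent:
  assumes n: "n > 0" and z: "z \<in> carrier (dihedral_group (2 * n))"
    and "z \<otimes>\<^bsub>dihedral_group (2 * n)\<^esub> z = z"
  shows "z = \<one>\<^bsub>dihedral_group (2 * n)\<^esub>"
proof -
  obtain i s where z_eq: "z = (i, s)" by (cases z)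
  have "\<not> s" and i: "2 * i mod int n = i" "0 \<le> i" "i < int n"
    using assms z_eq dihedral_group_square[OF n z] carrier_dihedral_group[OF n] by (auto split: if_splits)
  have "int n dvd 2 * i - i" using i(1) mod_eq_dvd_iff[of "2 * i" "int n" i] i(2,3) by simp
  then have "i = 0" using i zdvd_not_zless[of i "int n"] by fastforce
  then show ?thesis using z_eq \<open>\<not> s\<close> by (simp add: dihedral_group_def Let_def)
qed

lemma card_carrier_dihedral_group: "n > 0 \<Longrightarrow> card (carrier (dihedral_group (2 * n))) = 2 * n"
  by (simp add: carrier_dihedral_group card_cartesian_product)

text \<open>For odd \<open>n\<close> no nontrivial rotation has order two, so the involutions are
  exactly the reflections.\<close>

lemma card_involutions_dihedral_group:
  assumes "odd n"
  shows "card (involutions (dihedral_group (2 * n))) = n"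
proof -
  have n: "n > 0" using assms by (cases n) auto
  have one: "\<one>\<^bsub>dihedral_group (2 * n)\<^esub> = (0, False)" by (simp add: dihedral_group_def Let_def)
  have "i = 0" if "0 \<le> i" "i < int n" "2 * i mod int n = 0" for i
  proof -
    have "int n dvd 2 * i" using that by (simp add: mod_eq_0_iff_dvd)
    moreover have "coprime (int n) 2" using assms by simp
    ultimately have "int n dvd i" using coprime_dvd_mult_right_iff by blast
    then show ?thesis using that zdvd_not_zless[of i "int n"] by fastforce
  qed
  note double = this
  have "z \<in> involutions (dihedral_group (2 * n)) \<longleftrightarrow> z \<in> {0..<int n} \<times> {True}" for z
    using dihedral_group_square[OF n, of z] carrier_dihedral_group[OF n] double[of "fst z"]
    by (cases z) (auto simp: involutions_def one split: if_splits)
  then have "involutions (dihedral_group (2 * n)) = {0..<int n} \<times> {True}" by blast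
  then show ?thesis by (simp add: card_cartesian_product)
qed

section \<open>Elementary abelian 2-groups\<close>

lemma group_elem_abelian_2_group: "group (elem_abelian_2_group n)"
  by (simp add: elem_abelian_2_group_def)

lemma card_elem_abelian_2_group: "card (carrier (elem_abelian_2_group n)) = 2 ^ n"
  by (simp add: elem_abelian_2_group_def carrier_integer_mod_group card_PiE)

lemma elem_abelian_2_group_square:
  assumes "z \<in> carrier (elem_abelian_2_group n)"
  shows "z \<otimes>\<^bsub>elem_abelian_2_group n\<^esub> z = \<one>\<^bsub>elem_abelian_2_group n\<^esub>"
  by (auto simp: elem_abelian_2_group_def fun_eq_iff restrict_def)

lemma (in group) iso_elem_abelian_2_group:
  assumes "G \<cong> elem_abelian_2_group n"
  shows "card (carrier G) = 2 ^ n" and "z \<in> carrier G \<Longrightarrow> z \<otimes> z = \<one>"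
proof -
  show "card (carrier G) = 2 ^ n" using iso_same_card[OF assms] card_elem_abelian_2_group by simp
  assume z: "z \<in> carrier G"
  let ?E = "elem_abelian_2_group n"
  obtain h where h: "h \<in> iso G ?E" using assms by (auto simp: is_iso_def)
  have hom: "h \<in> hom G ?E" and inj: "inj_on h (carrier G)" using h by (auto simp: iso_def bij_betw_def)
  have "h (z \<otimes> z) = \<one>\<^bsub>?E\<^esub>"
    using hom_mult[OF hom z z] elem_abelian_2_group_square hom_in_carrier[OF hom z] by simp
  also have "\<dots> = h \<one>"
    using group.idempotent_eq_one[OF group_elem_abelian_2_group hom_in_carrier[OF hom one_closed]
        iso_one_idempotent[OF h]] by simp
  finally show "z \<otimes> z = \<one>" using inj z by (simp add: inj_on_eq_iff)
qed

subsection \<open>The group SL(2,q) in characteristic two\<close>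

lemma group_SL: "group (SL :: ('a::field^'n^'n) monoid)"
proof (rule groupI)
  fix A :: "'a^'n^'n" assume A: "A \<in> carrier SL"
  then have "invertible A" by (simp add: SL_def invertible_det_nz)
  then obtain B where B: "B ** A = mat 1" by (auto simp: invertible_def)
  have "det B * det A = 1" using B by (metis det_mul det_I)
  then have "B \<in> carrier SL" using A by (simp add: SL_def)
  then show "\<exists>B\<in>carrier SL. B \<otimes>\<^bsub>SL\<^esub> A = \<one>\<^bsub>SL\<^esub>" using B by (auto simp: SL_def)
qed (auto simp: SL_def det_mul matrix_mul_assoc)

section \<open>Two by two matrices over a field of even order\<close>

definition mat2 :: "'a \<Rightarrow> 'a \<Rightarrow> 'a \<Rightarrow> 'a \<Rightarrow> 'a::field^2^2" where
  "mat2 a b c d = (\<chi> i j. if i = 1 then if j = 1 then a else b else if j = 1 then c else d)"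

lemma mat2_eq_iff [simp]: "mat2 a b c d = mat2 a' b' c' d' \<longleftrightarrow> a = a' \<and> b = b' \<and> c = c' \<and> d = d'"
  by (auto simp: mat2_def vec_eq_iff forall_2)

lemma mat2_cases: obtains a b c d where "A = mat2 a b c d"
  by (rule that[of "A$1$1" "A$1$2" "A$2$1" "A$2$2"]) (simp add: mat2_def vec_eq_iff forall_2)

lemma det_mat2 [simp]: "det (mat2 a b c d) = a * d - b * c"
  by (simp add: det_2 mat2_def)

lemma mat2_mult [simp]:
  "mat2 a b c d ** mat2 a' b' c' d' =
    mat2 (a * a' + b * c') (a * b' + b * d') (c * a' + d * c') (c * b' + d * d')"
  by (simp add: mat2_def matrix_matrix_mult_def vec_eq_iff forall_2 sum_2)

lemma mat_eq_mat2: "(mat c :: 'a::field^2^2) = mat2 c 0 0 c"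
  by (simp add: mat2_def mat_def vec_eq_iff forall_2)

context
  fixes q :: nat
  assumes q: "CARD('a::{field,finite}) = q" "even q" "q > 2"
begin

text \<open>If \<open>1 + 1\<close> were nonzero, the pairs {y, -y} would partition the nonzero
  elements into two-element sets, making q - 1 even.\<close>

lemma char_2: "(x :: 'a) + x = 0"
proof (rule ccontr)
  assume "x + x \<noteq> 0"
  then have two: "(1 + 1 :: 'a) \<noteq> 0" by (metis distrib_left mult_1_right mult_zero_right)
  have ne: "- y \<noteq> y" if "y \<noteq> 0" for y :: 'a
  proof
    assume "- y = y"
    then have "y * (1 + 1) = 0" by (metis add.right_inverse distrib_left mult_1_right)
    then show False using two that by simp
  qed
  have "2 dvd card (\<Union>((\<lambda>y::'a. {y, - y}) ` (UNIV - {0})))"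
  proof (rule dvd_partition)
    show "\<forall>c\<in>(\<lambda>y::'a. {y, - y}) ` (UNIV - {0}). 2 dvd card c"
    proof
      fix c assume "c \<in> (\<lambda>y::'a. {y, - y}) ` (UNIV - {0})"
      then obtain y :: 'a where "y \<noteq> 0" "c = {y, - y}" by blast
      then have "card c = 2" using ne[of y] by (metis card_2_iff)
      then show "2 dvd card c" by simp
    qed
  qed auto
  moreover have "\<Union>((\<lambda>y::'a. {y, - y}) ` (UNIV - {0})) = UNIV - {0}" by auto
  ultimately have "even (card (UNIV - {0 :: 'a}))" by simp
  then show False using q by (simp add: card_Diff_singleton)
qed

lemma two_eq_0: "(2 :: 'a) = 0"
  using char_2[of 1] by simp

lemma uminus_eq: "- x = (x :: 'a)"
  using char_2 by (simp add: minus_unique)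

lemma minus_eq_plus: "x - y = x + (y :: 'a)"
  by (simp only: diff_conv_add_uminus uminus_eq)

lemma square_eq_iff_eq: "x * x = y * y \<longleftrightarrow> x = (y :: 'a)"
  using uminus_eq by (metis square_eq_iff)

text \<open>Squaring is injective in characteristic two, hence surjective on the finite
  field.\<close>

lemma ex_sqrt: "\<exists>x. x * x = (y :: 'a)"
proof -
  have "inj (\<lambda>x :: 'a. x * x)" by (simp add: inj_on_def square_eq_iff_eq)
  then have "surj (\<lambda>x :: 'a. x * x)" by (simp add: finite_UNIV_inj_surj)
  then show ?thesis by (metis surjD)
qed

text \<open>The inverse of the Frobenius map; the chosen root is unique by
  \<open>square_eq_iff_eq\<close>.\<close>

definition sqrt2 :: "'a \<Rightarrow> 'a" where "sqrt2 y = (SOME x. x * x = y)"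

lemma sqrt2: "sqrt2 y * sqrt2 y = y"
  unfolding sqrt2_def using someI_ex[OF ex_sqrt] .

lemma sqrt2_unique: "x * x = y \<Longrightarrow> x = sqrt2 y"
  using sqrt2 square_eq_iff_eq by metis

lemma mat2_in_SL: "mat2 a b c d \<in> carrier (SL :: ('a^2^2) monoid) \<longleftrightarrow> a * d + b * c = 1"
  by (simp add: SL_def minus_eq_plus)

text \<open>Split by the upper left entry \<open>a\<close>. For nonzero \<open>a\<close> the entry
  \<open>d\<close> is determined, giving (q - 1) q^2 matrices; for \<open>a = 0\<close> the entry
  \<open>c\<close> is determined by \<open>b\<close>, giving (q - 1) q.\<close>

lemma order_SL2: "order (SL :: ('a^2^2) monoid) = q * (q\<^sup>2 - 1)"
proof -
  let ?X = "(\<lambda>(a, b, c). mat2 a b c ((1 + b * c) / a)) ` ((UNIV - {0 :: 'a}) \<times> UNIV \<times> UNIV)"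
  let ?Y = "(\<lambda>(b, d). mat2 0 b (1 / b) d) ` ((UNIV - {0 :: 'a}) \<times> UNIV)"
  have S: "carrier SL = ?X \<union> ?Y"
  proof (intro equalityI subsetI)
    fix A :: "'a^2^2" assume "A \<in> carrier SL"
    moreover obtain a b c d where A: "A = mat2 a b c d" by (rule mat2_cases)
    ultimately have det: "a * d + b * c = 1" by (simp add: mat2_in_SL)
    show "A \<in> ?X \<union> ?Y"
    proof (cases "a = 0")
      case True
      then have "b \<noteq> 0" using det by auto
      moreover from this have "c = 1 / b" using det True by (simp add: eq_divide_eq mult.commute)
      ultimately have "A \<in> ?Y" using A True by (intro image_eqI[of _ _ "(b, d)"]) auto
      then show ?thesis ..
    next
      case False
      have "a * d = 1 - b * c" using det by (simp add: algebra_simps)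
      then have "d = (1 + b * c) / a" using False by (simp add: field_simps minus_eq_plus)
      then have "A \<in> ?X" using A False by (intro image_eqI[of _ _ "(a, b, c)"]) auto
      then show ?thesis ..
    qed
  next
    fix A :: "'a^2^2" assume "A \<in> ?X \<union> ?Y"
    then show "A \<in> carrier SL"
    proof
      assume "A \<in> ?X"
      then obtain a b c where "a \<noteq> 0" "A = mat2 a b c ((1 + b * c) / a)" by auto
      then show ?thesis by (simp add: mat2_in_SL add.assoc char_2 two_eq_0)
    next
      assume "A \<in> ?Y"
      then obtain b d where "b \<noteq> 0" "A = mat2 0 b (1 / b) d" by auto
      then show ?thesis by (simp add: mat2_in_SL)
    qed
  qed
  have cX: "card ?X = (q - 1) * (q * q)"
    by (subst card_image) (auto simp: inj_on_def card_cartesian_product q card_Diff_singleton)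
  have cY: "card ?Y = (q - 1) * q"
    by (subst card_image) (auto simp: inj_on_def card_cartesian_product q card_Diff_singleton)
  have "order (SL :: ('a^2^2) monoid) = card ?X + card ?Y"
    unfolding order_def S by (rule card_Un_disjoint) auto
  also have "\<dots> = (q - 1) * (q * q) + (q - 1) * q" unfolding cX cY ..
  also have "\<dots> = q * (q\<^sup>2 - 1)"
    using q(3) by (cases q) (auto simp: power2_eq_square algebra_simps)
  finally show ?thesis .
qed

text \<open>An involution has trace 0, that is \<open>a = d\<close>, and then the determinant
  determines \<open>a\<close> from \<open>b\<close> and \<open>c\<close>. The pair (0, 0) gives the
  identity.\<close>

lemma involutions_SL2:
  "involutions (SL :: ('a^2^2) monoid) =
    (\<lambda>(b, c). mat2 (sqrt2 (1 + b * c)) b c (sqrt2 (1 + b * c))) ` (UNIV - {(0, 0)})"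
proof (intro equalityI subsetI)
  fix A :: "'a^2^2" assume A: "A \<in> involutions SL"
  obtain a b c d where abcd: "A = mat2 a b c d" by (rule mat2_cases)
  have det: "a * d + b * c = 1"
    and sq: "a * a + b * c = 1" "a * b + b * d = 0" "c * a + d * c = 0" "c * b + d * d = 1"
    and ne: "\<not> (a = 1 \<and> b = 0 \<and> c = 0 \<and> d = 1)"
    using A abcd by (auto simp: involutions_def mat2_in_SL SL_def mat_eq_mat2 minus_eq_plus)
  \<comment> \<open>A nonzero trace would annihilate \<open>b\<close> and \<open>c\<close>, leaving
    a diagonal matrix whose entries have square 1 and so are both 1.\<close>
  have ad: "a = d"
  proof (rule ccontr)
    assume "a \<noteq> d"
    then have "a + d \<noteq> 0" using minus_eq_plus by (metis right_minus_eq)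
    moreover have "b * (a + d) = 0" "c * (a + d) = 0" using sq by (simp_all add: algebra_simps)
    ultimately have "b = 0" "c = 0" by auto
    then have "a * a = 1 * 1" "d * d = 1 * 1" using sq by auto
    then show False using \<open>a \<noteq> d\<close> unfolding square_eq_iff_eq by simp
  qed
  have "a * a = 1 - b * c" using sq(1) by (simp add: algebra_simps)
  then have a: "a = sqrt2 (1 + b * c)" by (intro sqrt2_unique) (simp add: minus_eq_plus)
  have "(b, c) \<noteq> (0, 0)"
  proof
    assume "(b, c) = (0, 0)"
    then have "a * a = 1 * 1" using sq by simp
    then have "a = 1" unfolding square_eq_iff_eq .
    then show False using ne ad \<open>(b, c) = (0, 0)\<close> by simp
  qed
  then show "A \<in> (\<lambda>(b, c). mat2 (sqrt2 (1 + b * c)) b c (sqrt2 (1 + b * c))) ` (UNIV - {(0, 0)})"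
    using abcd a ad by (intro image_eqI[of _ _ "(b, c)"]) auto
next
  fix A :: "'a^2^2"
  assume "A \<in> (\<lambda>(b, c). mat2 (sqrt2 (1 + b * c)) b c (sqrt2 (1 + b * c))) ` (UNIV - {(0, 0)})"
  then obtain b c where bc: "A = mat2 (sqrt2 (1 + b * c)) b c (sqrt2 (1 + b * c))" "(b, c) \<noteq> (0, 0)"
    by auto
  then show "A \<in> involutions SL"
    by (auto simp: involutions_def mat2_in_SL mat_eq_mat2 sqrt2 add.assoc char_2)
      (auto simp: SL_def mat_eq_mat2 sqrt2 add.assoc char_2 two_eq_0 mult.commute minus_eq_plus)
qed

lemma card_involutions_SL2: "card (involutions (SL :: ('a^2^2) monoid)) = q\<^sup>2 - 1"
proof -
  have "card (UNIV - {(0 :: 'a, 0 :: 'a)}) = q\<^sup>2 - 1"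
    by (simp add: card_Diff_singleton q power2_eq_square)
  then show ?thesis unfolding involutions_SL2 by (subst card_image) (auto simp: inj_on_def)
qed

text \<open>Commuting forces equal diagonal entries and an off-diagonal pair proportional to (b, c).
  The factor \<open>s\<close> is the only parameter, as the determinant fixes the diagonal.\<close>

lemma centralizer_SL2:
  assumes bc: "(b, c) \<noteq> (0, 0)"
  shows "centralizer (SL :: ('a^2^2) monoid) (mat2 a b c a) =
    (\<lambda>s. mat2 (sqrt2 (1 + s * b * (s * c))) (s * b) (s * c) (sqrt2 (1 + s * b * (s * c)))) ` UNIV"
proof (intro equalityI subsetI)
  fix A :: "'a^2^2" assume A: "A \<in> centralizer SL (mat2 a b c a)"
  obtain x y z w where xyzw: "A = mat2 x y z w" by (rule mat2_cases)
  have det: "x * w + y * z = 1"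
    and "x * a + y * c = a * x + b * z" "x * b + y * a = a * y + b * w"
    and "z * a + w * c = c * x + a * z" "z * b + w * a = c * y + a * w"
    using A xyzw by (auto simp: centralizer_def mat2_in_SL SL_def minus_eq_plus)
  then have yz: "y * c = b * z" and "x * b = b * w" "w * c = c * x" by (auto simp: algebra_simps)
  then have xw: "x = w" using bc by (auto simp: mult.commute)
  obtain s where s: "y = s * b" "z = s * c"
  proof (cases "b = 0")
    case True
    then have "c \<noteq> 0" "y = 0" using bc yz by auto
    then show thesis using that[of "z / c"] True by simp
  next
    case False
    then show thesis using that[of "y / b"] yz by (simp add: field_simps)
  qed
  have "x * x = 1 - y * z" using det xw by (simp add: algebra_simps)
  then have "x = sqrt2 (1 + s * b * (s * c))"
    unfolding s by (intro sqrt2_unique) (simp add: minus_eq_plus)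
  then show "A \<in> (\<lambda>s. mat2 (sqrt2 (1 + s * b * (s * c))) (s * b) (s * c) (sqrt2 (1 + s * b * (s * c)))) ` UNIV"
    using xyzw s xw by blast
next
  fix A :: "'a^2^2"
  assume "A \<in> (\<lambda>s. mat2 (sqrt2 (1 + s * b * (s * c))) (s * b) (s * c) (sqrt2 (1 + s * b * (s * c)))) ` UNIV"
  then obtain s where
    s: "A = mat2 (sqrt2 (1 + s * b * (s * c))) (s * b) (s * c) (sqrt2 (1 + s * b * (s * c)))" by blast
  have "A \<in> carrier SL" unfolding s mat2_in_SL sqrt2 by (simp add: add.assoc char_2)
  moreover have "A ** mat2 a b c a = mat2 a b c a ** A"
    unfolding s by (simp add: algebra_simps)
  ultimately show "A \<in> centralizer SL (mat2 a b c a)" by (simp add: centralizer_def SL_def)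
qed

lemma even_PSL2_SL2: "even_PSL2 (SL :: ('a^2^2) monoid) q"
proof -
  interpret group "SL :: ('a^2^2) monoid" by (rule group_SL)
  show ?thesis
  proof
    show "even q" "q > 2" using q by auto
    show "order (SL :: ('a^2^2) monoid) = q * (q\<^sup>2 - 1)" by (rule order_SL2)
    show "card (involutions (SL :: ('a^2^2) monoid)) = q\<^sup>2 - 1" by (rule card_involutions_SL2)
  next
    fix t :: "'a^2^2" assume "t \<in> involutions SL"
    then obtain b c a where bc: "(b, c) \<noteq> (0, 0)" and t: "t = mat2 a b c a"
      unfolding involutions_SL2 by auto
    have "inj (\<lambda>s. mat2 (sqrt2 (1 + s * b * (s * c))) (s * b) (s * c) (sqrt2 (1 + s * b * (s * c))))"
      using bc by (auto simp: inj_on_def)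
    then show "card (centralizer SL t) = q"
      unfolding t centralizer_SL2[OF bc] by (simp add: card_image q)
    fix s assume "s \<in> centralizer SL t"
    then show "s \<otimes>\<^bsub>SL\<^esub> s = \<one>\<^bsub>SL\<^esub>"
      unfolding t centralizer_SL2[OF bc]
      by (auto simp: SL_def mat_eq_mat2 sqrt2 add.assoc char_2 two_eq_0 mult.commute)
  qed
qed

text \<open>In characteristic two, c^2 = 1 forces c = 1, so the subgroup of scalars divided out is
  trivial.\<close>

lemma PSL2_iso_SL2: "(PSL :: ('a^2^2) set monoid) \<cong> (SL :: ('a^2^2) monoid)"
proof -
  interpret group "SL :: ('a^2^2) monoid" by (rule group_SL)
  have "{A \<in> carrier SL. \<exists>c. A = mat c} = {\<one>\<^bsub>SL\<^esub> :: 'a^2^2}"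
  proof -
    have "mat2 c 0 0 c = mat2 1 0 0 1" if "mat2 c 0 0 c \<in> carrier (SL :: ('a^2^2) monoid)" for c
      using that square_eq_iff_eq[of c 1] by (simp add: mat2_in_SL)
    then have scalar: "mat c = (mat 1 :: 'a^2^2)" if "mat c \<in> carrier (SL :: ('a^2^2) monoid)" for c
      using that unfolding mat_eq_mat2 by blast
    have one: "(\<one>\<^bsub>SL\<^esub> :: 'a^2^2) = mat 1" by (simp add: SL_def)
    have "{A \<in> carrier SL. \<exists>c. A = mat c} \<subseteq> {\<one>\<^bsub>SL\<^esub> :: 'a^2^2}"
      unfolding one using scalar by blast
    moreover have "(\<one>\<^bsub>SL\<^esub> :: 'a^2^2) \<in> {A \<in> carrier SL. \<exists>c. A = mat c}"
      using one_closed one by blast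
    ultimately show ?thesis by blast
  qed
  then show ?thesis unfolding PSL_def using is_isoI[OF trivial_factor_iso] by simp
qed

lemma even_PSL2_of_iso:
  assumes "group H" and iso: "H \<cong> (PSL :: ('a^2^2) set monoid)"
  shows "even_PSL2 H q"
proof -
  have "H \<cong> (SL :: ('a^2^2) monoid)" using iso_trans[OF iso PSL2_iso_SL2] .
  then have "(SL :: ('a^2^2) monoid) \<cong> H" using group.iso_sym[OF assms(1)] by blast
  then show ?thesis using even_PSL2_iso[OF even_PSL2_SL2 assms(1)] by blast
qed

end

subsection \<open>The design\<close>

text \<open>The stabilizer is abelian by its exponent, so it lies in the centralizer of any of its
  involutions, and equals it by order.\<close>

lemma (in even_PSL2_action) elementary_abelian_stabilizer_imp_Fix:
  assumes C: "C \<subseteq> P" "card C = q div 2" and card_stab: "card (set_stabilizer C) = q"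
    and square: "\<And>h. h \<in> set_stabilizer C \<Longrightarrow> h \<otimes> h = \<one>"
  obtains s where "s \<in> involutions G" "C = Fix s"
proof -
  let ?W = "set_stabilizer C"
  have W: "subgroup ?W G" using set_stabilizer_subgroup[OF C(1)] .
  have "\<not> ?W \<subseteq> {\<one>}"
  proof
    assume "?W \<subseteq> {\<one>}"
    then have "card ?W \<le> card {\<one>}" by (intro card_mono) auto
    with card_stab q_gt show False by simp
  qed
  then obtain t where t: "t \<in> ?W" "t \<noteq> \<one>" by blast
  have tI: "t \<in> involutions G"
    using t square[OF t(1)] subgroup.subset[OF W] unfolding involutions_def by blast
  have "?W \<subseteq> centralizer G t"
  proof
    fix h assume h: "h \<in> ?W"
    have c: "h \<in> carrier G" "t \<in> carrier G" using h t subgroup.subset[OF W] by auto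
    have "h \<otimes> t = t \<otimes> h"
      using c square[OF h] square[OF t(1)] square[OF subgroup.m_closed[OF W h t(1)]]
      by (rule square_one_imp_commute)
    then show "h \<in> centralizer G t" using c by (simp add: centralizer_def)
  qed
  then have "?W = centralizer G t"
    using card_stab card_centralizer[OF tI] finite_subset[OF centralizer_subset[OF tI] finite_carrier]
    by (intro card_subset_eq) auto
  then have "\<phi> u ` C = C" if "u \<in> centralizer G t" for u
    using that by (metis set_stabilizer_iff)
  then show thesis using centralizer_invariant_eq_Fix[OF tI _ C] that by blast
qed

text \<open>The generating set is a union of normal subgroups and hence closed under
  conjugation.\<close>

lemma (in group) normal_socle: "socle G \<lhd> G"
  unfolding socle_def
proof (rule normal_generateI)
  show "\<Union> {N. minimal_normal N G} \<subseteq> carrier G"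
    by (auto simp: minimal_normal_def dest: normal_imp_subgroup subgroup.subset)
  fix h g assume "h \<in> \<Union> {N. minimal_normal N G}" "g \<in> carrier G"
  then show "g \<otimes> h \<otimes> inv g \<in> \<Union> {N. minimal_normal N G}"
    by (auto simp: minimal_normal_def intro: normal.inv_op_closed2)
qed

section \<open>Automorphisms of a design acting on its points\<close>

lemma group_action_BijGroup: "group_action (BijGroup P) P (\<lambda>g. g)"
  by (simp add: group_action_def group_hom_def group_hom_axioms_def group_BijGroup hom_def)

lemma design_aut_subgroup:
  assumes "\<forall>B\<in>Bs. B \<subseteq> P"
  shows "subgroup {g \<in> Bij P. (\<lambda>B. g ` B) ` Bs = Bs} (BijGroup P)"
proof -
  interpret group_action "BijGroup P" P "\<lambda>g. g" by (rule group_action_BijGroup)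
  interpret group "BijGroup P" by (rule group_BijGroup)
  have car: "carrier (BijGroup P) = Bij P" by (simp add: BijGroup_def)
  show ?thesis
  proof (rule subgroupI)
    have "(\<lambda>B. \<one>\<^bsub>BijGroup P\<^esub> ` B) ` Bs = (\<lambda>B. B) ` Bs"
      using assms by (intro image_cong) (auto simp: image_act_one simp del: image_ident)
    then show "{g \<in> Bij P. (\<lambda>B. g ` B) ` Bs = Bs} \<noteq> {}" using one_closed car by auto
  next
    fix g assume "g \<in> {g \<in> Bij P. (\<lambda>B. g ` B) ` Bs = Bs}"
    then have g: "g \<in> carrier (BijGroup P)" "(\<lambda>B. g ` B) ` Bs = Bs" using car by auto
    have "(\<lambda>B. (inv\<^bsub>BijGroup P\<^esub> g) ` B) ` (\<lambda>B. g ` B) ` Bs = (\<lambda>B. B) ` Bs"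
      unfolding image_image[of _ "\<lambda>B. g ` B"]
      using assms image_act_inv[OF g(1)] by (intro image_cong) auto
    then show "inv\<^bsub>BijGroup P\<^esub> g \<in> {g \<in> Bij P. (\<lambda>B. g ` B) ` Bs = Bs}"
      using g inv_closed[OF g(1)] car by simp
  next
    fix g h assume "g \<in> {g \<in> Bij P. (\<lambda>B. g ` B) ` Bs = Bs}" "h \<in> {g \<in> Bij P. (\<lambda>B. g ` B) ` Bs = Bs}"
    then have g: "g \<in> carrier (BijGroup P)" "(\<lambda>B. g ` B) ` Bs = Bs"
      and h: "h \<in> carrier (BijGroup P)" "(\<lambda>B. h ` B) ` Bs = Bs" using car by auto
    have "(\<lambda>B. (g \<otimes>\<^bsub>BijGroup P\<^esub> h) ` B) ` Bs = (\<lambda>B. g ` B) ` (\<lambda>B. h ` B) ` Bs"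
      unfolding image_image[of _ "\<lambda>B. h ` B"]
      by (rule image_cong[OF refl]) (use assms image_act_mult[OF g(1) h(1)] in blast)
    then show "g \<otimes>\<^bsub>BijGroup P\<^esub> h \<in> {g \<in> Bij P. (\<lambda>B. g ` B) ` Bs = Bs}"
      using g h m_closed[OF g(1) h(1)] car by simp
  qed (use car in auto)
qed

lemma group_action_design_aut_group:
  assumes "\<forall>B\<in>Bs. B \<subseteq> P"
  shows "group_action (design_aut_group P Bs) P (\<lambda>g. g)"
  unfolding design_aut_group_def
  by (rule group_action.induced_action[OF group_action_BijGroup design_aut_subgroup[OF assms]])

theorem theorem2p2:
  fixes f q v b r k :: nat
  assumes "q = 2 ^ f" and "q > 8"
    and "CARD('f::{field,finite}) = q"
    and "v = q * (q - 1) div 2" and "b = 2 * (q ^ 2 - 1)" and "r = 2 * (q + 1)" and "k = q div 2"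
  shows "\<not> (\<exists>(P :: 'a set) (Bs :: 'a set set) (G :: ('a \<Rightarrow> 'a) set) (T :: ('a \<Rightarrow> 'a) set) x B.
            nontrivial_two_design P Bs v k 2 \<and>
            card Bs = b \<and>
            (\<forall>y\<in>P. card {C \<in> Bs. y \<in> C} = r) \<and>
            subgroup G (design_aut_group P Bs) \<and>
            flag_transitive P Bs G \<and>
            T = socle ((design_aut_group P Bs)\<lparr>carrier := G\<rparr>) \<and>
            (design_aut_group P Bs)\<lparr>carrier := T\<rparr> \<cong> (PSL :: ('f^2^2) set monoid) \<and>
            x \<in> P \<and> B \<in> Bs \<and>
            (let A = design_aut_group P Bs;
                 Tx = stabilizer (A\<lparr>carrier := T\<rparr>) (\<lambda>g. g) x;
                 TB = stabilizer (A\<lparr>carrier := T\<rparr>) (\<lambda>g C. g ` C) B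
             in A\<lparr>carrier := Tx\<rparr> \<cong> dihedral_group (2 * (q + 1)) \<and>
                (A\<lparr>carrier := TB\<rparr> \<cong> elem_abelian_2_group (f - 1) \<or>
                 A\<lparr>carrier := TB\<rparr> \<cong> elem_abelian_2_group f)))"
proof (rule notI, elim exE conjE)
  fix P :: "'a set" and Bs G T x B
  let ?A = "design_aut_group P Bs"
  let ?H = "?A\<lparr>carrier := T\<rparr>"
  let ?Tx = "stabilizer ?H (\<lambda>g. g) x" and ?TB = "stabilizer ?H (\<lambda>g C. g ` C) B"
  assume design: "nontrivial_two_design P Bs v k 2" and card_Bs: "card Bs = b"
    and repl: "\<forall>y\<in>P. card {C \<in> Bs. y \<in> C} = r"
    and G: "subgroup G ?A" and flag: "flag_transitive P Bs G"
    and T: "T = socle (?A\<lparr>carrier := G\<rparr>)" and PSL: "?H \<cong> (PSL :: ('f^2^2) set monoid)"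
    and x: "x \<in> P" and B: "B \<in> Bs"
    and "let A = ?A; Tx = stabilizer (A\<lparr>carrier := T\<rparr>) (\<lambda>g. g) x;
             TB = stabilizer (A\<lparr>carrier := T\<rparr>) (\<lambda>g C. g ` C) B
         in A\<lparr>carrier := Tx\<rparr> \<cong> dihedral_group (2 * (q + 1)) \<and>
            (A\<lparr>carrier := TB\<rparr> \<cong> elem_abelian_2_group (f - 1) \<or>
             A\<lparr>carrier := TB\<rparr> \<cong> elem_abelian_2_group f)"
  then have Tx: "?A\<lparr>carrier := ?Tx\<rparr> \<cong> dihedral_group (2 * (q + 1))"
    and TB: "?A\<lparr>carrier := ?TB\<rparr> \<cong> elem_abelian_2_group (f - 1) \<or>
      ?A\<lparr>carrier := ?TB\<rparr> \<cong> elem_abelian_2_group f"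
    by (simp_all add: Let_def)
  have P: "finite P" "card P = v" and Bs: "\<forall>C\<in>Bs. C \<subseteq> P \<and> card C = k"
    and pairs: "\<forall>y\<in>P. \<forall>z\<in>P. y \<noteq> z \<longrightarrow> card {C \<in> Bs. y \<in> C \<and> z \<in> C} = 2"
    using design by (auto simp: nontrivial_two_design_def two_design_def)
  have f: "f > 0" using assms(1,2) by (cases f) auto
  then have q2: "q = 2 * 2 ^ (f - 1)" using assms(1) by (cases f) auto
  interpret actA: group_action ?A P "\<lambda>g. g"
    by (rule group_action_design_aut_group) (use Bs in blast)
  interpret A: group ?A using actA.group_hom by (simp add: group_hom_def)
  have GA: "G \<subseteq> carrier ?A" using subgroup.subset[OF G] .
  have grpG: "group (?A\<lparr>carrier := G\<rparr>)" using subgroup.subgroup_is_group[OF G A.is_group] .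
  have T_normal: "T \<lhd> ?A\<lparr>carrier := G\<rparr>" unfolding T by (rule group.normal_socle[OF grpG])
  have T_sub: "subgroup T ?A"
    using A.incl_subgroup[OF G normal_imp_subgroup[OF T_normal]] .
  have grpH: "group ?H" using subgroup.subgroup_is_group[OF T_sub A.is_group] .
  interpret H: group_action ?H P "\<lambda>g. g" by (rule actA.induced_action[OF T_sub])
  have PSL2: "even_PSL2 ?H q"
    by (rule even_PSL2_of_iso[OF assms(3) _ _ grpH PSL]) (use q2 assms(2) in auto)
  have Tx_sub: "subgroup ?Tx ?H" using H.stabilizer_subgroup[OF x] .
  have grpTx: "group (?H\<lparr>carrier := ?Tx\<rparr>)" using subgroup.subgroup_is_group[OF Tx_sub grpH] .
  have isoTx: "?H\<lparr>carrier := ?Tx\<rparr> \<cong> dihedral_group (2 * (q + 1))" using Tx by simp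
  have "card ?Tx = 2 * (q + 1)"
    using iso_same_card[OF isoTx] card_carrier_dihedral_group[of "q + 1"] by simp
  moreover have "card (involutions ?H \<inter> ?Tx) = q + 1"
  proof -
    obtain h where h: "h \<in> iso (?H\<lparr>carrier := ?Tx\<rparr>) (dihedral_group (2 * (q + 1)))"
      using isoTx by (auto simp: is_iso_def)
    have "card (involutions (?H\<lparr>carrier := ?Tx\<rparr>)) = card (involutions (dihedral_group (2 * (q + 1))))"
      by (rule group.iso_card_involutions[OF grpTx h]) (rule dihedral_group_idempotent, auto)
    \<comment> \<open>The count of reflections applies because \<open>q + 1\<close> is odd.\<close>
    also have "\<dots> = q + 1" by (rule card_involutions_dihedral_group) (simp add: q2)
    finally show ?thesis
      using involutions_carrier_update[OF subgroup.subset[OF Tx_sub]] by simp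
  qed
  ultimately interpret PA: even_PSL2_action ?H q P "\<lambda>g. g" x
    using PSL2 H.group_action_axioms P x assms(4)
    by (simp add: even_PSL2_action_def even_PSL2_action_axioms_def)
  have BP: "B \<subseteq> P" and card_B: "card B = q div 2" using Bs B assms(7) by auto
  have TB_sub: "subgroup ?TB ?H" using H.set_stabilizer_subgroup[OF BP] .
  have grpTB: "group (?H\<lparr>carrier := ?TB\<rparr>)" using subgroup.subgroup_is_group[OF TB_sub grpH] .
  from TB show False
  proof
    assume "?A\<lparr>carrier := ?TB\<rparr> \<cong> elem_abelian_2_group (f - 1)"
    then have iso: "?H\<lparr>carrier := ?TB\<rparr> \<cong> elem_abelian_2_group (f - 1)" by simp
    have "biplane_action ?H q P (\<lambda>g. g) x Bs B"
    proof unfold_locales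
      show "q > 4" using assms(2) by simp
      show "C \<subseteq> P" "card C = q div 2" if "C \<in> Bs" for C using Bs that assms(7) by auto
      show "g ` C \<in> Bs" if "g \<in> carrier ?H" "C \<in> Bs" for g C
      proof -
        have "g \<in> carrier ?A" using that(1) subgroup.subset[OF T_sub] by auto
        then have "(\<lambda>B. g ` B) ` Bs = Bs" by (simp add: design_aut_group_def)
        then show ?thesis using that(2) by blast
      qed
      show "card {C \<in> Bs. y \<in> C \<and> z \<in> C} = 2" if "y \<in> P" "z \<in> P" "y \<noteq> z" for y z
        using pairs that by blast
      show "card {C \<in> Bs. y \<in> C} = 2 * (q + 1)" if "y \<in> P" for y using repl that assms(6) by simp
      show "card Bs = 2 * (q\<^sup>2 - 1)" using card_Bs assms(5) by simp
      show "B \<in> Bs" by fact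
      show "card ?TB = q div 2" using group.iso_elem_abelian_2_group(1)[OF grpTB iso] q2 by simp
      show "h \<otimes>\<^bsub>?H\<^esub> h = \<one>\<^bsub>?H\<^esub>" if "h \<in> ?TB" for h
        using group.iso_elem_abelian_2_group(2)[OF grpTB iso, of h] that by simp
    qed
    then show False by (rule biplane_action.no_such_action)
  next
    assume "?A\<lparr>carrier := ?TB\<rparr> \<cong> elem_abelian_2_group f"
    then have iso: "?H\<lparr>carrier := ?TB\<rparr> \<cong> elem_abelian_2_group f" by simp
    have card_TB: "card ?TB = q" using group.iso_elem_abelian_2_group(1)[OF grpTB iso] assms(1) by simp
    have square: "h \<otimes>\<^bsub>?H\<^esub> h = \<one>\<^bsub>?H\<^esub>" if "h \<in> ?TB" for h
      using group.iso_elem_abelian_2_group(2)[OF grpTB iso, of h] that by simp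
    obtain s where s: "s \<in> involutions ?H" "B = PA.Fix s"
      using PA.elementary_abelian_stabilizer_imp_Fix[OF BP card_B card_TB square] .
    have sT: "s \<in> T" "s \<in> carrier ?A"
      using s(1) subgroup.subset[OF T_sub] by (auto simp: involutions_def)
    \<comment> \<open>Now the orbit of \<open>B\<close> under \<open>T\<close> has only q^2 - 1
      blocks, half of them all. The remaining blocks are reached by flag-transitivity of
      \<open>G\<close>, and normality of \<open>T\<close> in \<open>G\<close> keeps the conjugated
      involutions in \<open>T\<close>.\<close>
    have "Bs \<subseteq> PA.Fix ` involutions ?H"
    proof
      fix C assume C: "C \<in> Bs"
      \<comment> \<open>Blocks are nonempty since \<open>q div 2 > 0\<close>, so each belongs to a
        flag.\<close>
      have ne: "D \<noteq> {}" if "D \<in> Bs" for D using Bs that assms(2,7) by fastforce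
      obtain y z where yz: "y \<in> B" "z \<in> C" using ne B C by blast
      then obtain g where g: "g \<in> G" "g ` B = C"
        using flag B C Bs unfolding flag_transitive_def by (meson subsetD)
      let ?s = "g \<otimes>\<^bsub>?A\<^esub> s \<otimes>\<^bsub>?A\<^esub> inv\<^bsub>?A\<^esub> g"
      have gA: "g \<in> carrier ?A" using g(1) GA by blast
      have "?s \<in> T"
        using normal.inv_op_closed2[OF T_normal, of g s] g(1) sT A.m_inv_consistent[OF G g(1)] by simp
      moreover have "s \<in> involutions ?A" using s(1) sT by (simp add: involutions_def)
      then have "?s \<in> involutions ?A" by (rule A.involution_conj[OF gA])
      ultimately have "?s \<in> involutions ?H" by (simp add: involutions_def)
      moreover have "C = PA.Fix ?s" using actA.invariants_conj[OF gA sT(2)] g(2) s(2) by simp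
      ultimately show "C \<in> PA.Fix ` involutions ?H" by blast
    qed
    then have "card Bs \<le> card (involutions ?H)" using PA.finite_involutions by (rule surj_card_le[rotated])
    then have "2 * (q\<^sup>2 - 1) \<le> q\<^sup>2 - 1" using card_Bs assms(5) PA.card_involutions by simp
    \<comment> \<open>This makes \<open>q\<^sup>2 - 1\<close> positive, so that it cannot be at
      least its own double.\<close>
    moreover have "q\<^sup>2 > 1" using assms(2) using less_1_mult[of q q] by (simp add: power2_eq_square)
    ultimately show False by simp
  qed
qed

end
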